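(* Let $\Omega\subseteq\mathbb{R}^3$ be a bounded domain, $\mathscr{C}=\Omega\times(0,\infty)$, and $w\in L^2(\mathscr{C},\mathbb{B})$. Then, for each choice of sign, the parabolic Teodorescu transform $$T_{\mathscr{C},\pm}[w](x,t)=\int_0^t\int_{\mathbb{R}^3}\exp(2\pi i\langle x,k\rangle)\exp(\mp2\pi k(t-s))\,\mathcal{F}(w)(k,s)\,dk\,ds$$ is well defined for almost all $(x,t)\in\mathbb{R}^3\times(0,\infty)$.
   Context: $\mathbb{B}=\mathbb{H}+i\mathbb{H}$ denotes the biquaternions, where $\mathbb{H}$ is the real quaternions with units $1,e_1,e_2,e_3$ and the complex imaginary unit $i$ commutes with $e_1,e_2,e_3$. $L^2(\mathscr{C},\mathbb{B})$ consists of the functions all of whose components are in $L^2(\mathscr{C})$. Functions on $\mathscr{C}$ are extended by zero to $(\mathbb{R}^3\setminus\overline\Omega)\times(0,\infty)$. The Fourier transform is taken in the spatial variable only, componentwise: $\mathcal{F}(w)(k,s)=\int_{\mathbb{R}^3}\exp(-2\pi i\langle k,x\rangle)w(x,s)\,dx$, where $\langle k,x\rangle=\sum_{j=1}^3k_jx_j$; it is extended to $L^2(\mathbb{R}^3)$ as usual, with inverse $\mathcal{F}^{-1}(f)(x)=\mathcal{F}(f)(-x)$. Integrals of the form $\int_{\mathbb{R}^3}\exp(2\pi i\langle x,k\rangle)g(k)\,dk$ with $g\in L^2(\mathbb{R}^3)$ stand for $\mathcal{F}^{-1}(g)(x)$. In the factor $\exp(\mp2\pi k(t-s))$ the vector $k\in\mathbb{R}^3$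 is identified with the quaternion $\sum_{j=1}^3k_je_j$, and the quaternionic exponential is $\exp(\mp2\pi k\tau)=\cos(2\pi|k|\tau)\mp\frac{k}{|k|}\sin(2\pi|k|\tau)$, multiplied from the left. *)

theory Defs
  imports "HOL-Analysis.Analysis"
begin

section \<open>Biquaternions\<close>

text \<open>
  The vector \<open>q\<close> stands for \<open>q$0 + q$1 e\<^sub>1 + q$2 e\<^sub>2 + q$3 e\<^sub>3\<close> with complex coefficients
  (\<open>0 = 4\<close> in the index type). The product is \<open>\<odot>\<close>; the operation \<open>*\<close> that the library
  provides on vectors is componentwise and is not used.
\<close>

type_synonym biquat = "complex ^ 4"

definition bq :: "complex \<Rightarrow> complex \<Rightarrow> complex \<Rightarrow> complex \<Rightarrow> biquat" where
  "bq a b c d = (\<chi> j. if j = 0 then a else if j = 1 then b else if j = 2 then c else d)"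

definition bq_times :: "biquat \<Rightarrow> biquat \<Rightarrow> biquat" (infixl "\<odot>" 70) where
  "p \<odot> q = bq
     (p$0 * q$0 - p$1 * q$1 - p$2 * q$2 - p$3 * q$3)
     (p$0 * q$1 + p$1 * q$0 + p$2 * q$3 - p$3 * q$2)
     (p$0 * q$2 - p$1 * q$3 + p$2 * q$0 + p$3 * q$1)
     (p$0 * q$3 + p$1 * q$2 - p$2 * q$1 + p$3 * q$0)"

lemma bq_nth [simp]:
  "bq a b c d $ 0 = a" "bq a b c d $ 1 = b" "bq a b c d $ 2 = c" "bq a b c d $ 3 = d"
  by (simp_all add: bq_def)

lemma bq_eq_iff: "p = q \<longleftrightarrow> p$0 = q$0 \<and> p$1 = q$1 \<and> p$2 = q$2 \<and> p$3 = q$3"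
  for p q :: biquat
proof -
  have "(0::4) = 4" by simp
  then show ?thesis unfolding vec_eq_iff forall_4 by metis
qed

lemma bq_units:
  defines "e1 \<equiv> bq 0 1 0 0" and "e2 \<equiv> bq 0 0 1 0" and "e3 \<equiv> bq 0 0 0 1"
  shows "e1 \<odot> e1 = - bq 1 0 0 0" "e2 \<odot> e2 = - bq 1 0 0 0" "e3 \<odot> e3 = - bq 1 0 0 0"
    and "e1 \<odot> e2 = e3" "e2 \<odot> e3 = e1" "e3 \<odot> e1 = e2"
    and "e2 \<odot> e1 = - e3" "e3 \<odot> e2 = - e1" "e1 \<odot> e3 = - e2"
  by (simp_all add: bq_eq_iff bq_times_def e1_def e2_def e3_def)

lemma bq_one: "bq 1 0 0 0 \<odot> p = p" "p \<odot> bq 1 0 0 0 = p"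
  by (simp_all add: bq_eq_iff bq_times_def)

lemma bq_assoc: "(p \<odot> q) \<odot> r = p \<odot> (q \<odot> r)"
  by (simp add: bq_eq_iff bq_times_def algebra_simps)

lemma bq_complex_central: "bq z 0 0 0 \<odot> p = p \<odot> bq z 0 0 0"
  by (simp add: bq_eq_iff bq_times_def algebra_simps)

definition quat_of_vec :: "real ^ 3 \<Rightarrow> biquat" where
  "quat_of_vec k = bq 0 (of_real (k$1)) (of_real (k$2)) (of_real (k$3))"

text \<open>
  \<open>quat_exp \<sigma> k \<tau>\<close> is \<open>exp (- \<sigma> 2 \<pi> k \<tau>)\<close>, so that \<open>\<sigma> = 1\<close> is the upper and \<open>\<sigma> = -1\<close> the
  lower sign of \<open>\<mp>\<close>. For \<open>k = 0\<close> the value is \<open>1\<close>.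
\<close>

definition quat_exp :: "real \<Rightarrow> real ^ 3 \<Rightarrow> real \<Rightarrow> biquat" where
  "quat_exp \<sigma> k \<tau> =
     bq (of_real (cos (2 * pi * norm k * \<tau>))) 0 0 0
     - (\<sigma> * sin (2 * pi * norm k * \<tau>)) *\<^sub>R quat_of_vec (k /\<^sub>R norm k)"


section \<open>The Fourier transform on \<open>L\<^sup>1\<close> and its extension to \<open>L\<^sup>2\<close>\<close>

definition L2_on :: "'a::euclidean_space set \<Rightarrow> ('a \<Rightarrow> complex) set" where
  "L2_on S = {f. f \<in> borel_measurable (lebesgue_on S) \<and>
                 integrable (lebesgue_on S) (\<lambda>x. (cmod (f x))\<^sup>2)}"

definition bq_L2_on :: "'a::euclidean_space set \<Rightarrow> ('a \<Rightarrow> biquat) set" where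
  "bq_L2_on S = {f. \<forall>j. (\<lambda>x. f x $ j) \<in> L2_on S}"

definition fourier_L1 :: "(real ^ 3 \<Rightarrow> complex) \<Rightarrow> real ^ 3 \<Rightarrow> complex" where
  "fourier_L1 f k = (LINT x|lebesgue. exp (- 2 * of_real pi * \<i> * of_real (k \<bullet> x)) * f x)"

text \<open>
  \<open>g\<close> is the value at \<open>f\<close> of the continuous extension to \<open>L\<^sup>2\<close> of the transform on
  \<open>L\<^sup>1 \<inter> L\<^sup>2\<close>. It is determined by \<open>f\<close> only up to null sets.
\<close>

definition is_fourier_L2 :: "(real ^ 3 \<Rightarrow> complex) \<Rightarrow> (real ^ 3 \<Rightarrow> complex) \<Rightarrow> bool" where
  "is_fourier_L2 f g \<longleftrightarrow> f \<in> L2_on UNIV \<and> g \<in> L2_on UNIV \<and>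
     (\<exists>\<phi>. (\<forall>n::nat. integrable lebesgue (\<phi> n) \<and> \<phi> n \<in> L2_on UNIV) \<and>
          (\<lambda>n. \<integral>\<^sup>+x. ennreal ((cmod (\<phi> n x - f x))\<^sup>2) \<partial>lebesgue) \<longlonglongrightarrow> 0 \<and>
          (\<lambda>n. \<integral>\<^sup>+k. ennreal ((cmod (fourier_L1 (\<phi> n) k - g k))\<^sup>2) \<partial>lebesgue) \<longlonglongrightarrow> 0)"

definition fourier :: "(real ^ 3 \<Rightarrow> complex) \<Rightarrow> real ^ 3 \<Rightarrow> complex" where
  "fourier f = (if integrable lebesgue f then fourier_L1 f else (SOME g. is_fourier_L2 f g))"

definition bq_fourier :: "(real ^ 3 \<Rightarrow> biquat) \<Rightarrow> real ^ 3 \<Rightarrow> biquat" where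
  "bq_fourier f k = (\<chi> j. fourier (\<lambda>x. f x $ j) k)"

definition bq_fourier_inv :: "(real ^ 3 \<Rightarrow> biquat) \<Rightarrow> real ^ 3 \<Rightarrow> biquat" where
  "bq_fourier_inv f x = bq_fourier f (- x)"


section \<open>The parabolic Teodorescu transform\<close>

definition cylinder :: "(real ^ 3) set \<Rightarrow> ((real ^ 3) \<times> real) set" where
  "cylinder \<Omega> = \<Omega> \<times> {0<..}"

definition zero_ext :: "'a set \<Rightarrow> ('a \<Rightarrow> 'b::zero) \<Rightarrow> 'a \<Rightarrow> 'b" where
  "zero_ext S f p = (if p \<in> S then f p else 0)"

definition teodorescu_spectrum ::
  "(real ^ 3) set \<Rightarrow> real \<Rightarrow> ((real ^ 3) \<times> real \<Rightarrow> biquat) \<Rightarrow> real \<Rightarrow> real \<Rightarrow> real ^ 3 \<Rightarrow> biquat" where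
  "teodorescu_spectrum \<Omega> \<sigma> w t s k =
     quat_exp \<sigma> k (t - s) \<odot> bq_fourier (\<lambda>x. zero_ext (cylinder \<Omega>) w (x, s)) k"

text \<open>
  For fixed \<open>s\<close> and \<open>t\<close> the inner integral is an \<open>L\<^sup>2\<close> inverse Fourier transform, hence a function
  of \<open>x\<close> up to null sets only. To integrate it in \<open>s\<close> for fixed \<open>x\<close> one needs a version \<open>H\<close> that
  is measurable in \<open>(x, t, s)\<close> jointly.
\<close>

definition teodorescu_version ::
  "(real ^ 3) set \<Rightarrow> real \<Rightarrow> ((real ^ 3) \<times> real \<Rightarrow> biquat) \<Rightarrow> ((real ^ 3) \<times> real \<times> real \<Rightarrow> biquat) \<Rightarrow> bool"
  where
  "teodorescu_version \<Omega> \<sigma> w H \<longleftrightarrow>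
     H \<in> borel_measurable (lebesgue_on {(x, t, s). 0 < s \<and> s < t}) \<and>
     (AE (t, s) in lebesgue_on {(t, s). 0 < s \<and> s < t}.
        AE x in lebesgue. H (x, t, s) = bq_fourier_inv (teodorescu_spectrum \<Omega> \<sigma> w t s) x)"

definition teodorescu ::
  "(real ^ 3) set \<Rightarrow> real \<Rightarrow> ((real ^ 3) \<times> real \<Rightarrow> biquat) \<Rightarrow> (real ^ 3) \<times> real \<Rightarrow> biquat" where
  "teodorescu \<Omega> \<sigma> w = (\<lambda>(x, t).
     LINT s:{0<..<t}|lebesgue. (SOME H. teodorescu_version \<Omega> \<sigma> w H) (x, t, s))"

end

theory Submission
  imports Defs "HOL-Probability.Characteristic_Functions"
begin

text \<open>
  Write \<open>\<W>(k, s)\<close> for the spatial Fourier transform of the slice \<open>w(\<cdot>, s)\<close>. Since \<open>\<Omega>\<close> has finite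
  measure, almost every slice is both integrable and square integrable, so \<open>\<W>\<close> is given by an
  honest integral and is measurable in \<open>(k, s)\<close> jointly. The quaternionic exponential has entries of
  modulus at most \<open>1\<close>, so the spectrum \<open>exp(\<mp>2\<pi>k(t - s)) \<W>(k, s)\<close> is square integrable in \<open>k\<close>, with
  a bound that depends on \<open>s\<close> but not on \<open>t\<close>, and that is integrable over \<open>s\<close>.

  Of Plancherel's theorem only the inequality \<open>\<parallel>\<F> f\<parallel> \<le> \<parallel>f\<parallel>\<close> is used (\<open>bessel_inequality\<close>). It
  follows from the Gaussian integral: weighting \<open>|\<F> f|\<^sup>2\<close> by a Gaussian and interchanging integrals
  turns the left-hand side into a quadratic form in \<open>f\<close> whose kernel is a nonnegative approximate
  identity; the form is at most \<open>\<parallel>f\<parallel>\<^sup>2\<close>, and the weight is then removed by Fatou's lemma. The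
  inequality makes the \<open>L\<^sup>2\<close> extension of the transform unique up to null sets
  (\<open>is_fourier_L2_unique\<close>), so it does not matter which representative is chosen.

  The inner integral is, for each \<open>(t, s)\<close>, only a class of functions of \<open>x\<close>. A jointly measurable
  version comes from cutting the spectrum off at radii \<open>r\<^sub>0, r\<^sub>1, \<dots>\<close>: each cutoff has an ordinary Fourier
  integral, measurable in all variables. If the radii grow so fast that the tails of the total energy
  decay geometrically, then for almost every \<open>s\<close> and every \<open>t\<close> the Fourier integrals of the cutoffs
  converge for almost every \<open>x\<close>, along one and the same sequence of radii, and their limit is the
  \<open>L\<^sup>2\<close> transform (\<open>fourier_L2_parametrized\<close>).

  Two versions agree for almost every \<open>(x, t, s)\<close> by Tonelli's theorem, because joint measurability
  turns equality on almost every slice into equality almost everywhere. Finally, the version is square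
  integrable over \<open>\<real>\<^sup>3 \<times> [-n, n] \<times> \<real>\<close> for every \<open>n\<close>, so for almost every \<open>(x, t)\<close> it is square
  integrable in \<open>s\<close>, hence integrable over the bounded interval \<open>(0, t)\<close>.
\<close>

section \<open>Measurability\<close>

lemma borel_measurable_cis [measurable]: "cis \<in> borel_measurable borel"
  by (intro borel_measurable_continuous_onI continuous_intros)

lemma borel_measurable_cnj [measurable]: "cnj \<in> borel_measurable borel"
  by (intro borel_measurable_continuous_onI continuous_intros)

lemma borel_measurable_fst_snd [measurable]: "fst \<in> borel_measurable borel" "snd \<in> borel_measurable borel"
  by (intro borel_measurable_continuous_onI continuous_intros)+

lemma borel_measurable_pair_lborel:
  fixes f :: "'a::second_countable_topology \<times> 'b::euclidean_space \<Rightarrow> 'c::topological_space"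
  assumes "f \<in> borel_measurable borel"
  shows "f \<in> borel_measurable (borel \<Otimes>\<^sub>M lborel)"
proof -
  have "sets (borel \<Otimes>\<^sub>M lborel) = sets (borel :: ('a \<times> 'b) measure)"
    unfolding borel_prod[symmetric] by (rule sets_pair_measure_cong) simp_all
  then show ?thesis using assms by (simp cong: measurable_cong_sets)
qed

lemma borel_measurable_vec_nth [measurable (raw)]:
  fixes f :: "'a \<Rightarrow> 'b::euclidean_space ^ 'n"
  assumes "f \<in> borel_measurable M"
  shows "(\<lambda>x. f x $ i) \<in> borel_measurable M"
  by (rule borel_measurable_continuous_on[OF _ assms]) (intro continuous_intros)

lemma borel_measurable_vec_lambda [measurable (raw)]:
  fixes f :: "'a \<Rightarrow> 'n::finite \<Rightarrow> 'b::euclidean_space"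
  assumes "\<And>i. (\<lambda>x. f x i) \<in> borel_measurable M"
  shows "(\<lambda>x. \<chi> i. f x i) \<in> borel_measurable M"
proof (subst borel_measurable_euclidean_space, intro ballI)
  fix b :: "'b ^ 'n" assume "b \<in> Basis"
  then obtain i u where "b = axis i u" by (auto simp: Basis_vec_def)
  then show "(\<lambda>x. (\<chi> i. f x i) \<bullet> b) \<in> borel_measurable M"
    using assms[of i] by (simp add: inner_axis)
qed

lemma borel_measurable_bq [measurable (raw)]:
  assumes "a \<in> borel_measurable M" "b \<in> borel_measurable M" "c \<in> borel_measurable M" "d \<in> borel_measurable M"
  shows "(\<lambda>x. bq (a x) (b x) (c x) (d x)) \<in> borel_measurable M"
  unfolding bq_def by (intro borel_measurable_vec_lambda) (use assms in auto)

lemma borel_measurable_bq_times [measurable (raw)]: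
  assumes [measurable]: "p \<in> borel_measurable M" "q \<in> borel_measurable M"
  shows "(\<lambda>x. p x \<odot> q x) \<in> borel_measurable M"
  unfolding bq_times_def by measurable

lemma borel_measurable_quat_exp [measurable (raw)]:
  assumes [measurable]: "k \<in> borel_measurable M" "\<tau> \<in> borel_measurable M"
  shows "(\<lambda>x. quat_exp \<sigma> (k x) (\<tau> x)) \<in> borel_measurable M"
  unfolding quat_exp_def quat_of_vec_def by measurable

section \<open>Fourier transform of a Gaussian\<close>

text \<open>
  The substitution \<open>x = \<surd>(2 \<pi> a) k\<close> reduces the integral to the characteristic function of the
  standard normal distribution.
\<close>

lemma gaussian_fourier_real:
  fixes a z :: real
  assumes a: "a > 0"
  shows "integrable lborel (\<lambda>k. of_real (exp (- (pi * a * k\<^sup>2))) * cis (2 * pi * (k * z)))"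
    and "(LINT k|lborel. of_real (exp (- (pi * a * k\<^sup>2))) * cis (2 * pi * (k * z)))
           = of_real (exp (- (pi * z\<^sup>2 / a)) / sqrt a)"
proof -
  \<comment> \<open>the scaling that turns \<open>\<pi> a k\<^sup>2\<close> into the exponent \<open>x\<^sup>2 / 2\<close> of the normal density\<close>
  define c where "c = sqrt (2 * pi * a)"
  have c: "c > 0" and c2: "c\<^sup>2 = 2 * pi * a" using a by (simp_all add: c_def)
  define F where "F = (\<lambda>x. std_normal_density x *\<^sub>R cis ((2 * pi * z / c) * x))"
  have F_int: "integrable lborel F"
    unfolding F_def
    by (rule Bochner_Integration.integrable_bound[OF integrable_normal_density[of 1 0]]) auto
  have F_val: "(LINT x|lborel. F x) = of_real (exp (- ((2 * pi * z / c)\<^sup>2) / 2))"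
    using fun_cong[OF char_std_normal_distribution, of "2 * pi * z / c"]
    unfolding char_def F_def by (subst (asm) integral_density) (auto simp: cis_conv_exp)
  have F_eq: "F (0 + c * k) = of_real (1 / sqrt (2 * pi)) *
      (of_real (exp (- (pi * a * k\<^sup>2))) * cis (2 * pi * (k * z)))" for k
  proof -
    have "(2 * pi * z / c) * (c * k) = 2 * pi * (k * z)" using c by simp
    moreover have "(c * k)\<^sup>2 / 2 = pi * a * k\<^sup>2" by (simp add: power_mult_distrib c2)
    ultimately show ?thesis
      unfolding F_def normal_density_def by (simp add: scaleR_conv_of_real)
  qed
  have "integrable lborel (\<lambda>k. F (0 + c * k))"
    using F_int c by (subst lborel_integrable_real_affine_iff) auto
  from integrable_mult_right[OF this, of "of_real (sqrt (2 * pi))"]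
  show int: "integrable lborel (\<lambda>k. of_real (exp (- (pi * a * k\<^sup>2))) * cis (2 * pi * (k * z)))"
    unfolding F_eq by simp
  have e: "(2 * pi * z / c)\<^sup>2 / 2 = pi * z\<^sup>2 / a"
    unfolding power_divide power_mult_distrib c2 using a by (simp add: field_simps power2_eq_square)
  have "(LINT x|lborel. F x) = c *\<^sub>R (LINT k|lborel. F (0 + c * k))"
    using lborel_integral_real_affine[of c F 0] c by simp
  also have "\<dots> = of_real (c / sqrt (2 * pi)) *
      (LINT k|lborel. of_real (exp (- (pi * a * k\<^sup>2))) * cis (2 * pi * (k * z)))"
    unfolding F_eq by (simp add: scaleR_conv_of_real)
  also have "c / sqrt (2 * pi) = sqrt a"
    by (simp add: c_def real_sqrt_mult)
  finally show "(LINT k|lborel. of_real (exp (- (pi * a * k\<^sup>2))) * cis (2 * pi * (k * z)))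
           = of_real (exp (- (pi * z\<^sup>2 / a)) / sqrt a)"
    using a unfolding F_val minus_divide_left[symmetric] e
    by (simp add: nonzero_eq_divide_eq mult.commute)
qed

text \<open>
  The heat kernel \<open>a\<^bsup>-d/2\<^esup> exp(- \<pi> |z|\<^sup>2 / a)\<close>, written as a product over coordinates so that
  integrals over the whole space factor into integrals over the line.
\<close>

definition gauss_kernel :: "real \<Rightarrow> 'a::euclidean_space \<Rightarrow> real" where
  "gauss_kernel a z = (\<Prod>b\<in>Basis. exp (- (pi * (z \<bullet> b)\<^sup>2 / a)) / sqrt a)"

lemma gauss_kernel_measurable [measurable]: "gauss_kernel a \<in> borel_measurable borel"
  unfolding gauss_kernel_def by measurable

lemma gauss_kernel_nonneg: "a > 0 \<Longrightarrow> gauss_kernel a z \<ge> 0"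
  unfolding gauss_kernel_def by (intro prod_nonneg) auto

lemma gauss_kernel_minus: "gauss_kernel a (x - y) = gauss_kernel a (y - x)"
  unfolding gauss_kernel_def by (simp add: inner_diff_left power2_commute)

lemma nn_integral_gauss_kernel:
  assumes a: "a > 0"
  shows "(\<integral>\<^sup>+z. ennreal (gauss_kernel a (z::'a::euclidean_space)) \<partial>lborel) = 1"
proof -
  have 1: "(\<integral>\<^sup>+x. ennreal (exp (- (pi * x\<^sup>2 / a)) / sqrt a) \<partial>lborel) = 1"
  proof -
    have inv: "inverse a > 0" using a by simp
    have int: "integrable lborel (\<lambda>x. exp (- (pi * x\<^sup>2 / a)))"
      using integrable_Re[OF gaussian_fourier_real(1)[OF inv, of 0]] by (simp add: divide_inverse mult_ac)
    have "complex_of_real (LINT x|lborel. exp (- (pi * x\<^sup>2 / a))) = of_real (sqrt a)"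
      using gaussian_fourier_real(2)[OF inv, of 0] a
      by (simp add: divide_inverse mult_ac real_sqrt_inverse flip: integral_complex_of_real)
    then have val: "(LINT x|lborel. exp (- (pi * x\<^sup>2 / a)) / sqrt a) = 1"
      using a by (simp only: of_real_eq_iff) simp
    show ?thesis
      by (subst nn_integral_eq_integral) (use int a val in auto)
  qed
  have "(\<integral>\<^sup>+z. ennreal (gauss_kernel a (z::'a)) \<partial>lborel)
      = (\<integral>\<^sup>+z. (\<Prod>b\<in>Basis. ennreal (exp (- (pi * ((z::'a) \<bullet> b)\<^sup>2 / a)) / sqrt a)) \<partial>lborel)"
    unfolding gauss_kernel_def using a by (subst prod_ennreal) auto
  also have "\<dots> = (\<Prod>b\<in>(Basis::'a set). \<integral>\<^sup>+x. ennreal (exp (- (pi * x\<^sup>2 / a)) / sqrt a) \<partial>lborel)"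
    by (rule nn_integral_lborel_prod) auto
  finally show ?thesis by (simp add: 1)
qed

lemma lborel_prod_Basis:
  fixes f :: "'a::euclidean_space \<Rightarrow> real \<Rightarrow> complex"
  assumes "\<And>b. b \<in> Basis \<Longrightarrow> integrable lborel (f b)"
  shows "integrable lborel (\<lambda>x. \<Prod>b\<in>Basis. f b (x \<bullet> b))"
    and "(LINT x|lborel. (\<Prod>b\<in>Basis. f b (x \<bullet> b))) = (\<Prod>b\<in>Basis. LINT x|lborel. f b x)"
proof -
  interpret product_sigma_finite "\<lambda>_::'a. lborel::real measure" by standard
  have [measurable]: "b \<in> Basis \<Longrightarrow> f b \<in> borel_measurable borel" for b
    using assms[of b] by (simp add: borel_measurable_integrable)
  have *: "(\<Prod>b\<in>Basis. f b ((\<Sum>c\<in>Basis. y c *\<^sub>R c) \<bullet> b)) = (\<Prod>b\<in>Basis. f b (y b))" for y :: "'a \<Rightarrow> real"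
    by (intro prod.cong) auto
  show "integrable lborel (\<lambda>x. \<Prod>b\<in>Basis. f b (x \<bullet> b))"
    by (subst lborel_eq, subst integrable_distr_eq)
       (auto simp only: * intro!: product_integrable_prod assms, measurable)
  show "(LINT x|lborel. (\<Prod>b\<in>Basis. f b (x \<bullet> b))) = (\<Prod>b\<in>Basis. LINT x|lborel. f b x)"
    apply (subst lborel_eq, subst integral_distr)
    apply measurable
    apply (simp only: *)
    by (intro product_integral_prod assms) auto
qed

lemma gaussian_fourier:
  fixes z :: "'a::euclidean_space"
  assumes a: "a > 0"
  shows "integrable lborel (\<lambda>k. of_real (exp (- (pi * a * (norm k)\<^sup>2))) * cis (2 * pi * (k \<bullet> z)))"
    and "(LINT k|lborel. of_real (exp (- (pi * a * (norm k)\<^sup>2))) * cis (2 * pi * (k \<bullet> z)))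
           = of_real (gauss_kernel a z)"
proof -
  have *: "of_real (exp (- (pi * a * (norm k)\<^sup>2))) * cis (2 * pi * (k \<bullet> z))
     = (\<Prod>b\<in>Basis. of_real (exp (- (pi * a * (k \<bullet> b)\<^sup>2))) * cis (2 * pi * (k \<bullet> b * (z \<bullet> b))))" for k :: 'a
  proof -
    have 1: "(norm k)\<^sup>2 = (\<Sum>b\<in>Basis. (k \<bullet> b)\<^sup>2)"
      by (simp add: norm_eq_sqrt_inner euclidean_inner[of k k] power2_eq_square sum_nonneg)
    have 2: "cis (2 * pi * (k \<bullet> z)) = (\<Prod>b\<in>Basis. cis (2 * pi * (k \<bullet> b * (z \<bullet> b))))"
      by (subst euclidean_inner)
         (simp add: cis_conv_exp sum_distrib_left flip: exp_sum)
    have 3: "complex_of_real (exp (- (pi * a * (norm k)\<^sup>2))) = (\<Prod>b\<in>Basis. of_real (exp (- (pi * a * (k \<bullet> b)\<^sup>2))))"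
      unfolding 1 by (simp add: sum_distrib_left exp_sum flip: sum_negf)
    show ?thesis unfolding 2 3 by (simp add: prod.distrib)
  qed
  note i = gaussian_fourier_real[OF a]
  show "integrable lborel (\<lambda>k. of_real (exp (- (pi * a * (norm k)\<^sup>2))) * cis (2 * pi * (k \<bullet> z)))"
    unfolding * by (rule lborel_prod_Basis(1), rule i)
  show "(LINT k|lborel. of_real (exp (- (pi * a * (norm k)\<^sup>2))) * cis (2 * pi * (k \<bullet> z)))
           = of_real (gauss_kernel a z)"
    unfolding * gauss_kernel_def by (subst lborel_prod_Basis(2), rule i) (simp add: i)
qed

section \<open>Bessel's inequality for the Fourier integral\<close>

text \<open>
  The Fourier integral over the Borel sigma-algebra. For Borel functions it agrees with the Lebesgue
  integral, and it depends measurably on parameters without exceptional null sets.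
\<close>

definition ft :: "('a::euclidean_space \<Rightarrow> complex) \<Rightarrow> 'a \<Rightarrow> complex" where
  "ft f k = (LINT x|lborel. cis (- (2 * pi * (k \<bullet> x))) * f x)"

lemma integrable_lborel_borel [measurable_dest]: "integrable lborel f \<Longrightarrow> f \<in> borel_measurable borel"
  using borel_measurable_integrable by force

lemma integrable_cis_times:
  fixes f :: "'a::euclidean_space \<Rightarrow> complex"
  assumes [measurable]: "\<theta> \<in> borel_measurable borel" and f: "integrable lborel f"
  shows "integrable lborel (\<lambda>x. cis (\<theta> x) * f x)"
proof -
  note [measurable] = integrable_lborel_borel[OF f]
  show ?thesis
    by (rule Bochner_Integration.integrable_bound[OF f]) (auto simp: norm_mult)
qed

lemma ft_measurable_param [measurable (raw)]:
  fixes f :: "'b \<Rightarrow> 'a::euclidean_space \<Rightarrow> complex"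
  assumes [measurable]: "(\<lambda>(p, x). f p x) \<in> borel_measurable (M \<Otimes>\<^sub>M borel)"
    and [measurable]: "k \<in> borel_measurable M"
  shows "(\<lambda>p. ft (f p) (k p)) \<in> borel_measurable M"
proof -
  have [measurable]: "(\<lambda>(p, x). f p x) \<in> borel_measurable (M \<Otimes>\<^sub>M lborel)"
    using assms(1) by (simp cong: measurable_cong_sets)
  show ?thesis
    unfolding ft_def by (intro lborel.borel_measurable_lebesgue_integral) measurable
qed

lemma ft_diff:
  assumes "integrable lborel f" "integrable lborel g"
  shows "ft (\<lambda>x. f x - g x) k = ft f k - ft g k"
  unfolding ft_def right_diff_distrib
  by (intro Bochner_Integration.integral_diff integrable_cis_times assms) auto

lemma norm_integral_le_nn_integral:
  fixes f :: "'a \<Rightarrow> 'b::{banach, second_countable_topology}"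
  shows "ennreal (norm (LINT x|M. f x)) \<le> (\<integral>\<^sup>+x. ennreal (norm (f x)) \<partial>M)"
  by (cases "integrable M f") (auto simp: integral_norm_bound_ennreal not_integrable_integral_eq)

text \<open>
  Fatou's lemma in the form in which bounds pass to almost everywhere limits.
\<close>

lemma nn_integral_le_tendsto:
  fixes u :: "nat \<Rightarrow> 'a \<Rightarrow> ennreal"
  assumes "\<And>n. u n \<in> borel_measurable M" and "AE x in M. (\<lambda>n. u n x) \<longlonglongrightarrow> v x"
    and "\<And>n. (\<integral>\<^sup>+x. u n x \<partial>M) \<le> c n" and "c \<longlonglongrightarrow> C"
  shows "(\<integral>\<^sup>+x. v x \<partial>M) \<le> C"
proof -
  have "(\<integral>\<^sup>+x. v x \<partial>M) = (\<integral>\<^sup>+x. liminf (\<lambda>n. u n x) \<partial>M)"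
    using assms(2) by (intro nn_integral_cong_AE) (auto elim!: eventually_mono simp: lim_imp_Liminf)
  also have "\<dots> \<le> liminf (\<lambda>n. \<integral>\<^sup>+x. u n x \<partial>M)"
    by (rule nn_integral_liminf) fact
  also have "\<dots> \<le> liminf c"
    by (intro Liminf_mono always_eventually allI assms)
  also have "\<dots> = C"
    using assms(4) by (simp add: lim_imp_Liminf)
  finally show ?thesis .
qed

text \<open>
  The multiplication formula \<open>\<integral> \<F> h \<cdot> m = \<integral> h \<cdot> \<F> m\<close>, with a bounded kernel in place of the Fourier
  kernel, so that it also applies to conjugated and modulated exponentials.
\<close>

lemma integral_kernel_swap:
  fixes E :: "'a::euclidean_space \<Rightarrow> 'b::euclidean_space \<Rightarrow> complex"
  assumes [measurable]: "(\<lambda>(k, y). E k y) \<in> borel_measurable (borel \<Otimes>\<^sub>M borel)"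
    and E1: "\<And>k y. cmod (E k y) \<le> 1"
    and h: "integrable lborel h" and m: "integrable lborel m"
  shows "(LINT k|lborel. (LINT y|lborel. E k y * h y) * m k)
       = (LINT y|lborel. h y * (LINT k|lborel. E k y * m k))"
proof -
  note [measurable] = integrable_lborel_borel[OF h] integrable_lborel_borel[OF m]
  have "integrable (lborel \<Otimes>\<^sub>M lborel) (\<lambda>(k, y). m k * h y)"
    using h m by (intro lborel_pair.Fubini_integrable) (auto simp: norm_mult)
  then have int: "integrable (lborel \<Otimes>\<^sub>M lborel) (\<lambda>(k, y). E k y * h y * m k)"
    by (rule Bochner_Integration.integrable_bound)
       (auto simp: norm_mult mult_ac intro!: mult_left_mono mult_right_le_one_le E1 AE_I2)
  have "(LINT k|lborel. (LINT y|lborel. E k y * h y) * m k)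
      = (LINT k|lborel. (LINT y|lborel. E k y * h y * m k))"
    by simp
  also have "\<dots> = (LINT y|lborel. (LINT k|lborel. E k y * h y * m k))"
    using lborel_pair.Fubini_integral[OF int] by simp
  also have "\<dots> = (LINT y|lborel. h y * (LINT k|lborel. E k y * m k))"
    by (intro Bochner_Integration.integral_cong refl)
       (simp add: mult_ac flip: integral_mult_right_zero)
  finally show ?thesis .
qed

lemma nn_integral_gauss_kernel_shift:
  fixes x :: "'a::euclidean_space"
  assumes a: "a > 0"
  shows "(\<integral>\<^sup>+y. ennreal (gauss_kernel a (y - x)) \<partial>lborel) = 1"
proof -
  have "(\<integral>\<^sup>+y. ennreal (gauss_kernel a (y - x)) \<partial>lborel)
      = (\<integral>\<^sup>+y. ennreal (gauss_kernel a (y - x)) \<partial>distr lborel borel ((+) x))"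
    by (simp add: lborel_distr_plus)
  also have "\<dots> = (\<integral>\<^sup>+y. ennreal (gauss_kernel a (y::'a)) \<partial>lborel)"
    by (subst nn_integral_distr) auto
  finally show ?thesis by (simp add: nn_integral_gauss_kernel[OF a])
qed

text \<open>
  Two applications of Fubini's theorem give
  \<open>\<integral>|\<F> f(k)|\<^sup>2 exp(-\<pi> a |k|\<^sup>2) dk = \<integral>\<integral> f(x) cnj(f(y)) K(y - x) dy dx\<close> with \<open>K\<close> the heat kernel.
  Since \<open>K \<ge> 0\<close> is even and has integral \<open>1\<close>, the estimate
  \<open>|f(x) f(y)| \<le> |f(x)|\<^sup>2 / 2 + |f(y)|\<^sup>2 / 2\<close> bounds the right-hand side by the squared norm of \<open>f\<close>.
\<close>

lemma bessel_gauss: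
  fixes f :: "'a::euclidean_space \<Rightarrow> complex"
  assumes f: "integrable lborel f" and a: "a > 0"
  shows "(\<integral>\<^sup>+k. ennreal ((cmod (ft f k))\<^sup>2 * exp (- (pi * a * (norm k)\<^sup>2))) \<partial>lborel)
           \<le> (\<integral>\<^sup>+x. ennreal ((cmod (f x))\<^sup>2) \<partial>lborel)"
proof -
  define g where "g = (\<lambda>k::'a. complex_of_real (exp (- (pi * a * (norm k)\<^sup>2))))"
  define G where "G = (gauss_kernel a :: 'a \<Rightarrow> real)"
  note [measurable] = integrable_lborel_borel[OF f]
  have [measurable]: "g \<in> borel_measurable borel" unfolding g_def by measurable
  have [measurable]: "G \<in> borel_measurable borel" unfolding G_def by measurable
  have g_int: "integrable lborel g"
    using gaussian_fourier(1)[OF a, of 0] by (simp add: g_def)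
  have ft_le: "cmod (ft f k) \<le> (LINT x|lborel. cmod (f x))" for k
    unfolding ft_def by (rule order_trans[OF integral_norm_bound]) (simp add: norm_mult)
  have fg_int: "integrable lborel (\<lambda>k. cnj (ft f k) * g k)"
  proof (rule Bochner_Integration.integrable_bound)
    show "integrable lborel (\<lambda>k. of_real (LINT x|lborel. cmod (f x)) * g k)"
      using g_int by simp
    show "AE k in lborel. norm (cnj (ft f k) * g k) \<le> norm (of_real (LINT x|lborel. cmod (f x)) * g k)"
      using ft_le by (auto simp: norm_mult intro!: mult_right_mono order_trans[OF _ abs_ge_self])
  qed auto
  have ffg_int: "integrable lborel (\<lambda>k. (cmod (ft f k))\<^sup>2 * exp (- (pi * a * (norm k)\<^sup>2)))"
  proof (rule Bochner_Integration.integrable_bound)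
    show "integrable lborel (\<lambda>k. of_real ((LINT x|lborel. cmod (f x))\<^sup>2) * g k)"
      using g_int by simp
    show "AE k in lborel. norm ((cmod (ft f k))\<^sup>2 * exp (- (pi * a * (norm k)\<^sup>2)))
        \<le> norm (of_real ((LINT x|lborel. cmod (f x))\<^sup>2) * g k)"
      using ft_le by (auto simp: g_def norm_mult norm_power intro!: power_mono)
  qed auto
  have cnj_ft: "cnj (ft f k) = (LINT y|lborel. cis (2 * pi * (k \<bullet> y)) * cnj (f y))" for k
    unfolding ft_def by (subst Bochner_Integration.integral_cnj[symmetric]) (simp add: cis_cnj)
  have inner: "(LINT k|lborel. cis (- (2 * pi * (k \<bullet> x))) * (cnj (ft f k) * g k))
      = (LINT y|lborel. cnj (f y) * of_real (G (y - x)))" for x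
  proof -
    have "(LINT k|lborel. cis (- (2 * pi * (k \<bullet> x))) * (cnj (ft f k) * g k))
        = (LINT k|lborel. (LINT y|lborel. cis (2 * pi * (k \<bullet> y)) * cnj (f y)) * (cis (- (2 * pi * (k \<bullet> x))) * g k))"
      unfolding cnj_ft by (simp add: mult_ac)
    also have "\<dots> = (LINT y|lborel. cnj (f y) * (LINT k|lborel. cis (2 * pi * (k \<bullet> y)) * (cis (- (2 * pi * (k \<bullet> x))) * g k)))"
      using f by (intro integral_kernel_swap integrable_cis_times g_int) auto
    also have "\<dots> = (LINT y|lborel. cnj (f y) * of_real (G (y - x)))"
    proof (intro Bochner_Integration.integral_cong refl)
      fix y :: 'a
      have e: "cis (2 * pi * (k \<bullet> y)) * (cis (- (2 * pi * (k \<bullet> x))) * g k) = g k * cis (2 * pi * (k \<bullet> (y - x)))" for k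
        by (simp add: mult.assoc[symmetric] cis_mult) (simp add: inner_diff_right right_diff_distrib mult.commute)
      show "cnj (f y) * (LINT k|lborel. cis (2 * pi * (k \<bullet> y)) * (cis (- (2 * pi * (k \<bullet> x))) * g k))
          = cnj (f y) * of_real (G (y - x))"
        unfolding e using gaussian_fourier(2)[OF a, of "y - x"] by (simp add: g_def G_def)
    qed
    finally show ?thesis .
  qed
  have "complex_of_real (LINT k|lborel. (cmod (ft f k))\<^sup>2 * exp (- (pi * a * (norm k)\<^sup>2)))
      = (LINT k|lborel. (LINT x|lborel. cis (- (2 * pi * (k \<bullet> x))) * f x) * (cnj (ft f k) * g k))"
    unfolding ft_def[symmetric]
    by (subst integral_complex_of_real[symmetric]) (simp only: of_real_mult complex_norm_square g_def mult.assoc)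
  also have "\<dots> = (LINT x|lborel. f x * (LINT k|lborel. cis (- (2 * pi * (k \<bullet> x))) * (cnj (ft f k) * g k)))"
    by (intro integral_kernel_swap fg_int f) auto
  also have "\<dots> = (LINT x|lborel. f x * (LINT y|lborel. cnj (f y) * of_real (G (y - x))))"
    unfolding inner ..
  finally have J: "complex_of_real (LINT k|lborel. (cmod (ft f k))\<^sup>2 * exp (- (pi * a * (norm k)\<^sup>2))) = \<dots>" .
  have G0: "G z \<ge> 0" for z using a by (simp add: G_def gauss_kernel_nonneg)
  have G1: "(\<integral>\<^sup>+x. ennreal (G (y - x)) \<partial>lborel) = 1" for y
    using nn_integral_gauss_kernel_shift[OF a, of y] by (simp add: G_def gauss_kernel_minus[of a y])
  have "(\<integral>\<^sup>+k. ennreal ((cmod (ft f k))\<^sup>2 * exp (- (pi * a * (norm k)\<^sup>2))) \<partial>lborel)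
      = ennreal (LINT k|lborel. (cmod (ft f k))\<^sup>2 * exp (- (pi * a * (norm k)\<^sup>2)))"
    by (intro nn_integral_eq_integral ffg_int) auto
  also have "\<dots> \<le> ennreal (cmod (complex_of_real (LINT k|lborel. (cmod (ft f k))\<^sup>2 * exp (- (pi * a * (norm k)\<^sup>2)))))"
    by (intro ennreal_leI) simp
  also have "\<dots> \<le> (\<integral>\<^sup>+x. ennreal (cmod (f x * (LINT y|lborel. cnj (f y) * of_real (G (y - x))))) \<partial>lborel)"
    unfolding J by (rule norm_integral_le_nn_integral)
  also have "\<dots> \<le> (\<integral>\<^sup>+x. (\<integral>\<^sup>+y. ennreal (cmod (f x)) * ennreal (cmod (cnj (f y) * of_real (G (y - x)))) \<partial>lborel) \<partial>lborel)"
    by (intro nn_integral_mono)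
       (auto simp: norm_mult ennreal_mult nn_integral_cmult simp del: integral_mult_right_zero
         intro!: mult_left_mono order_trans[OF norm_integral_le_nn_integral])
  also have "\<dots> \<le> (\<integral>\<^sup>+x. (\<integral>\<^sup>+y. ennreal ((cmod (f x))\<^sup>2 / 2) * ennreal (G (y - x)) + ennreal ((cmod (f y))\<^sup>2 / 2) * ennreal (G (y - x)) \<partial>lborel) \<partial>lborel)"
  proof (intro nn_integral_mono)
    fix x y :: 'a
    have "0 \<le> (cmod (f x) - cmod (f y))\<^sup>2" by simp
    then have "cmod (f x) * cmod (f y) \<le> (cmod (f x))\<^sup>2 / 2 + (cmod (f y))\<^sup>2 / 2"
      by (simp add: power2_diff)
    then have "cmod (f x) * cmod (f y) * G (y - x) \<le> ((cmod (f x))\<^sup>2 / 2 + (cmod (f y))\<^sup>2 / 2) * G (y - x)"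
      by (intro mult_right_mono G0)
    then show "ennreal (cmod (f x)) * ennreal (cmod (cnj (f y) * of_real (G (y - x))))
       \<le> ennreal ((cmod (f x))\<^sup>2 / 2) * ennreal (G (y - x)) + ennreal ((cmod (f y))\<^sup>2 / 2) * ennreal (G (y - x))"
      using G0 by (simp add: norm_mult distrib_right mult.assoc flip: ennreal_mult ennreal_plus)
  qed
  also have "\<dots> = (\<integral>\<^sup>+x. ennreal ((cmod (f x))\<^sup>2 / 2) \<partial>lborel)
      + (\<integral>\<^sup>+x. (\<integral>\<^sup>+y. ennreal ((cmod (f y))\<^sup>2 / 2) * ennreal (G (y - x)) \<partial>lborel) \<partial>lborel)"
    by (simp add: nn_integral_add nn_integral_cmult nn_integral_gauss_kernel_shift[OF a] G_def)
  also have "(\<integral>\<^sup>+x. (\<integral>\<^sup>+y. ennreal ((cmod (f y))\<^sup>2 / 2) * ennreal (G (y - x)) \<partial>lborel) \<partial>lborel)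
      = (\<integral>\<^sup>+y. (\<integral>\<^sup>+x. ennreal ((cmod (f y))\<^sup>2 / 2) * ennreal (G (y - x)) \<partial>lborel) \<partial>lborel)"
    by (intro lborel_pair.Fubini'[symmetric]) measurable
  also have "\<dots> = (\<integral>\<^sup>+y. ennreal ((cmod (f y))\<^sup>2 / 2) \<partial>lborel)"
    by (simp add: nn_integral_cmult G1)
  also have "(\<integral>\<^sup>+x. ennreal ((cmod (f x))\<^sup>2 / 2) \<partial>lborel) + (\<integral>\<^sup>+x. ennreal ((cmod (f x))\<^sup>2 / 2) \<partial>lborel)
      = (\<integral>\<^sup>+x. ennreal ((cmod (f x))\<^sup>2) \<partial>lborel)"
    by (simp flip: nn_integral_add ennreal_plus)
  finally show ?thesis .
qed

text \<open>
  Let the width of the Gaussian weight tend to infinity and use Fatou's lemma. If \<open>f\<close> is not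
  integrable, then all the Bochner integrals are \<open>0\<close> by convention and the inequality is trivial;
  stating it without integrability spares a case distinction on exceptional time slices.
\<close>

lemma bessel_inequality:
  fixes f :: "'a::euclidean_space \<Rightarrow> complex"
  assumes [measurable]: "f \<in> borel_measurable borel"
  shows "(\<integral>\<^sup>+k. ennreal ((cmod (ft f k))\<^sup>2) \<partial>lborel) \<le> (\<integral>\<^sup>+x. ennreal ((cmod (f x))\<^sup>2) \<partial>lborel)"
proof (cases "integrable lborel f")
  case True
  show ?thesis
  proof (rule nn_integral_le_tendsto)
    show "(\<integral>\<^sup>+k. ennreal ((cmod (ft f k))\<^sup>2 * exp (- (pi * inverse (real (Suc n)) * (norm k)\<^sup>2))) \<partial>lborel)
        \<le> (\<integral>\<^sup>+x. ennreal ((cmod (f x))\<^sup>2) \<partial>lborel)" for n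
      by (rule bessel_gauss[OF True]) simp
    have "(\<lambda>n. (cmod (ft f k))\<^sup>2 * exp (- (pi * inverse (real (Suc n)) * (norm k)\<^sup>2)))
        \<longlonglongrightarrow> (cmod (ft f k))\<^sup>2 * exp (- (pi * 0 * (norm k)\<^sup>2))" for k
      by (intro tendsto_intros LIMSEQ_inverse_real_of_nat)
    then show "AE k in lborel. (\<lambda>n. ennreal ((cmod (ft f k))\<^sup>2 * exp (- (pi * inverse (real (Suc n)) * (norm k)\<^sup>2))))
        \<longlonglongrightarrow> ennreal ((cmod (ft f k))\<^sup>2)"
      by (intro AE_I2 tendsto_ennrealI) simp
  qed auto
next
  case False
  have "\<not> integrable lborel (\<lambda>x. cis (- (2 * pi * (k \<bullet> x))) * f x)" for k
  proof
    assume "integrable lborel (\<lambda>x. cis (- (2 * pi * (k \<bullet> x))) * f x)"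
    then have "integrable lborel (\<lambda>x. cis (2 * pi * (k \<bullet> x)) * (cis (- (2 * pi * (k \<bullet> x))) * f x))"
      by (rule integrable_cis_times[rotated]) measurable
    moreover have "cis (2 * pi * (k \<bullet> x)) * (cis (- (2 * pi * (k \<bullet> x))) * f x) = f x" for x
      by (simp add: mult.assoc[symmetric] cis_mult)
    ultimately show False using False by (simp only:)
  qed
  then have "ft f k = 0" for k
    unfolding ft_def by (rule not_integrable_integral_eq)
  then show ?thesis by simp
qed

section \<open>The Fourier transform on square integrable functions\<close>

text \<open>
  A Lebesgue measurable function may have exceptional sections that are not measurable; every section
  of a Borel function is Borel. Functions are therefore replaced by Borel representatives before
  Tonelli's theorem is used.
\<close>

lemma lebesgue_measurable_borel_rep:
  fixes f :: "'a::euclidean_space \<Rightarrow> complex"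
  assumes "f \<in> borel_measurable lebesgue"
  obtains f' where "f' \<in> borel_measurable borel" "AE x in lborel. f x = f' x"
proof -
  have "(\<lambda>x. Re (f x)) \<in> borel_measurable lebesgue" "(\<lambda>x. Im (f x)) \<in> borel_measurable lebesgue"
    using assms by measurable
  then obtain u v where uv: "u \<in> borel_measurable lborel" "v \<in> borel_measurable lborel"
    and eq: "AE x in lborel. Re (f x) = u x" "AE x in lborel. Im (f x) = v x"
    using completion_ex_borel_measurable_real by metis
  show ?thesis
  proof
    show "(\<lambda>x. Complex (u x) (v x)) \<in> borel_measurable borel"
      using uv unfolding borel_measurable_complex_iff by simp
    show "AE x in lborel. f x = Complex (u x) (v x)"
      using eq by eventually_elim (simp add: complex_eq_iff)
  qed
qed

lemma L2_on_UNIV_iff: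
  "f \<in> L2_on UNIV \<longleftrightarrow>
     f \<in> borel_measurable lebesgue \<and> (\<integral>\<^sup>+x. ennreal ((cmod (f x))\<^sup>2) \<partial>lborel) < \<infinity>"
  unfolding L2_on_def by (auto simp: integrable_iff_bounded nn_integral_completion lebesgue_on_UNIV_eq)

lemma integrable_lebesgue_cong_AE:
  fixes f g :: "'a::euclidean_space \<Rightarrow> 'b::euclidean_space"
  assumes ae: "AE x in lborel. f x = g x" and f: "integrable lebesgue f"
  shows "integrable lebesgue g" and "(LINT x|lebesgue. g x) = (LINT x|lebesgue. f x)"
proof -
  have ae': "AE x in lebesgue. f x = g x" using ae by (rule AE_completion)
  have m: "f \<in> borel_measurable lebesgue" using f by simp
  have g: "g \<in> borel_measurable lebesgue"
    using borel_measurable_AE[OF m ae'] .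
  show "integrable lebesgue g" using integrable_cong_AE[OF m g ae'] f by simp
  show "(LINT x|lebesgue. g x) = (LINT x|lebesgue. f x)"
    using integral_cong_AE[OF m g ae'] by simp
qed

lemma fourier_L1_eq_ft:
  assumes "f' \<in> borel_measurable borel" and ae: "AE x in lborel. f x = f' x"
  shows "fourier_L1 f = ft f'"
proof
  fix k
  note [measurable] = assms(1)
  have m: "(\<lambda>x. cis (- (2 * pi * (k \<bullet> x))) * f' x) \<in> borel_measurable borel" by measurable
  then have m': "(\<lambda>x. cis (- (2 * pi * (k \<bullet> x))) * f' x) \<in> borel_measurable lebesgue"
    by (intro measurable_completion) simp
  have *: "exp (- 2 * of_real pi * \<i> * of_real (k \<bullet> x)) = cis (- (2 * pi * (k \<bullet> x)))" for x
    by (simp add: cis_conv_exp mult_ac)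
  have ae': "AE x in lebesgue. cis (- (2 * pi * (k \<bullet> x))) * f' x = cis (- (2 * pi * (k \<bullet> x))) * f x"
    using AE_completion[OF ae] by eventually_elim simp
  have "(LINT x|lebesgue. cis (- (2 * pi * (k \<bullet> x))) * f x) = (LINT x|lebesgue. cis (- (2 * pi * (k \<bullet> x))) * f' x)"
    using integral_cong_AE[OF m' borel_measurable_AE[OF m' ae'] ae'] by simp
  also have "\<dots> = ft f' k"
    unfolding ft_def using m by (intro integral_completion) simp
  finally show "fourier_L1 f k = ft f' k"
    unfolding fourier_L1_def * .
qed

lemma fourier_L1_borel: "f \<in> borel_measurable borel \<Longrightarrow> fourier_L1 f = ft f"
  by (rule fourier_L1_eq_ft) auto

lemma
  assumes f: "f \<in> borel_measurable lebesgue"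
  shows fourier_L1_measurable: "fourier_L1 f \<in> borel_measurable borel"
    and bessel_fourier_L1: "(\<integral>\<^sup>+k. ennreal ((cmod (fourier_L1 f k))\<^sup>2) \<partial>lborel)
           \<le> (\<integral>\<^sup>+x. ennreal ((cmod (f x))\<^sup>2) \<partial>lborel)"
proof -
  obtain f' where [measurable]: "f' \<in> borel_measurable borel" and ae: "AE x in lborel. f x = f' x"
    using lebesgue_measurable_borel_rep[OF f] .
  note eq = fourier_L1_eq_ft[OF \<open>f' \<in> _\<close> ae]
  show "fourier_L1 f \<in> borel_measurable borel" unfolding eq by measurable
  have "(\<integral>\<^sup>+x. ennreal ((cmod (f x))\<^sup>2) \<partial>lborel) = (\<integral>\<^sup>+x. ennreal ((cmod (f' x))\<^sup>2) \<partial>lborel)"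
    using ae by (intro nn_integral_cong_AE) (auto elim!: eventually_mono)
  then show "(\<integral>\<^sup>+k. ennreal ((cmod (fourier_L1 f k))\<^sup>2) \<partial>lborel)
           \<le> (\<integral>\<^sup>+x. ennreal ((cmod (f x))\<^sup>2) \<partial>lborel)"
    unfolding eq using bessel_inequality[of f'] by simp
qed

lemma fourier_L1_diff:
  assumes f: "integrable lebesgue f" and g: "integrable lebesgue g"
  shows "fourier_L1 (\<lambda>x. f x - g x) k = fourier_L1 f k - fourier_L1 g k"
proof -
  have f': "f \<in> borel_measurable lebesgue" and g': "g \<in> borel_measurable lebesgue" using f g by auto
  have c: "(\<lambda>x. exp (- 2 * of_real pi * \<i> * of_real (k \<bullet> x))) \<in> borel_measurable lebesgue"
    by (intro measurable_completion) simp
  have "integrable lebesgue (\<lambda>x. exp (- 2 * of_real pi * \<i> * of_real (k \<bullet> x)) * h x)"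
    if "integrable lebesgue h" for h :: "real ^ 3 \<Rightarrow> complex"
    using that by (rule Bochner_Integration.integrable_bound)
      (use c that in \<open>auto simp: norm_mult\<close>)
  then show ?thesis
    unfolding fourier_L1_def right_diff_distrib using f g by (intro Bochner_Integration.integral_diff)
qed

lemma norm_add3_square_le:
  fixes a b c :: "'a::real_normed_vector"
  shows "(norm (a + b + c))\<^sup>2 \<le> 3 * ((norm a)\<^sup>2 + (norm b)\<^sup>2 + (norm c)\<^sup>2)"
proof -
  have "(norm (a + b + c))\<^sup>2 \<le> (norm a + norm b + norm c)\<^sup>2"
    by (intro power_mono norm_ge_zero norm_triangle_le add_right_mono norm_triangle_ineq)
  also have "\<dots> \<le> 3 * ((norm a)\<^sup>2 + (norm b)\<^sup>2 + (norm c)\<^sup>2)"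
    using sum_squares_ge_zero[of "norm a - norm b" "norm b - norm c"]
      zero_le_power2[of "norm a - norm c"]
    by (simp add: power2_eq_square algebra_simps)
  finally show ?thesis .
qed

lemma nn_integral_norm_add3_square_le:
  fixes a b c :: "'a \<Rightarrow> 'b::{real_normed_vector, second_countable_topology}"
  assumes [measurable]: "a \<in> borel_measurable M" "b \<in> borel_measurable M" "c \<in> borel_measurable M"
    and s: "\<And>x. s x = a x + b x + c x"
  shows "(\<integral>\<^sup>+x. ennreal ((norm (s x))\<^sup>2) \<partial>M)
     \<le> 3 * ((\<integral>\<^sup>+x. ennreal ((norm (a x))\<^sup>2) \<partial>M) + (\<integral>\<^sup>+x. ennreal ((norm (b x))\<^sup>2) \<partial>M)
        + (\<integral>\<^sup>+x. ennreal ((norm (c x))\<^sup>2) \<partial>M))"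
proof -
  have "(\<integral>\<^sup>+x. ennreal ((norm (s x))\<^sup>2) \<partial>M)
     \<le> (\<integral>\<^sup>+x. 3 * (ennreal ((norm (a x))\<^sup>2) + ennreal ((norm (b x))\<^sup>2) + ennreal ((norm (c x))\<^sup>2)) \<partial>M)"
  proof (intro nn_integral_mono)
    fix x
    have "ennreal ((norm (s x))\<^sup>2) \<le> ennreal (3 * ((norm (a x))\<^sup>2 + (norm (b x))\<^sup>2 + (norm (c x))\<^sup>2))"
      unfolding s by (intro ennreal_leI norm_add3_square_le)
    also have "\<dots> = 3 * (ennreal ((norm (a x))\<^sup>2) + ennreal ((norm (b x))\<^sup>2) + ennreal ((norm (c x))\<^sup>2))"
      by (subst ennreal_mult) (simp_all add: ennreal_plus del: power2_norm_eq_inner)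
    finally show "ennreal ((norm (s x))\<^sup>2)
        \<le> 3 * (ennreal ((norm (a x))\<^sup>2) + ennreal ((norm (b x))\<^sup>2) + ennreal ((norm (c x))\<^sup>2))" .
  qed
  then show ?thesis by (simp add: nn_integral_add nn_integral_cmult)
qed

text \<open>
  Bessel's inequality bounds the distance of the transforms of two approximating sequences by the
  distance of the sequences, which tends to \<open>0\<close>.
\<close>

lemma is_fourier_L2_unique:
  assumes "is_fourier_L2 f g" and "is_fourier_L2 f g'"
  shows "AE k in lborel. g k = g' k"
proof -
  have f: "f \<in> L2_on UNIV" and g: "g \<in> L2_on UNIV" and g': "g' \<in> L2_on UNIV"
    using assms unfolding is_fourier_L2_def by simp_all
  obtain \<phi> where \<phi>: "(\<forall>n. integrable lebesgue (\<phi> n) \<and> \<phi> n \<in> L2_on UNIV) \<and>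
      (\<lambda>n. \<integral>\<^sup>+x. ennreal ((cmod (\<phi> n x - f x))\<^sup>2) \<partial>lebesgue) \<longlonglongrightarrow> 0 \<and>
      (\<lambda>n. \<integral>\<^sup>+k. ennreal ((cmod (fourier_L1 (\<phi> n) k - g k))\<^sup>2) \<partial>lebesgue) \<longlonglongrightarrow> 0"
    using assms(1)[unfolded is_fourier_L2_def, THEN conjunct2, THEN conjunct2] by (rule exE)
  obtain \<psi> where \<psi>: "(\<forall>n. integrable lebesgue (\<psi> n) \<and> \<psi> n \<in> L2_on UNIV) \<and>
      (\<lambda>n. \<integral>\<^sup>+x. ennreal ((cmod (\<psi> n x - f x))\<^sup>2) \<partial>lebesgue) \<longlonglongrightarrow> 0 \<and>
      (\<lambda>n. \<integral>\<^sup>+k. ennreal ((cmod (fourier_L1 (\<psi> n) k - g' k))\<^sup>2) \<partial>lebesgue) \<longlonglongrightarrow> 0"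
    using assms(2)[unfolded is_fourier_L2_def, THEN conjunct2, THEN conjunct2] by (rule exE)
  have int: "integrable lebesgue (\<phi> n)" "integrable lebesgue (\<psi> n)" for n
    using \<phi> \<psi> by blast+
  define A where "A n = (\<integral>\<^sup>+x. ennreal ((cmod (\<phi> n x - f x))\<^sup>2) \<partial>lebesgue)" for n
  define B where "B n = (\<integral>\<^sup>+x. ennreal ((cmod (\<psi> n x - f x))\<^sup>2) \<partial>lebesgue)" for n
  define C where "C n = (\<integral>\<^sup>+k. ennreal ((cmod (fourier_L1 (\<phi> n) k - g k))\<^sup>2) \<partial>lebesgue)" for n
  define D where "D n = (\<integral>\<^sup>+k. ennreal ((cmod (fourier_L1 (\<psi> n) k - g' k))\<^sup>2) \<partial>lebesgue)" for n
  have [measurable]: "f \<in> borel_measurable lebesgue" "g \<in> borel_measurable lebesgue"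
      "g' \<in> borel_measurable lebesgue"
    using f g g' by (auto simp: L2_on_UNIV_iff)
  have meas [measurable]: "\<phi> n \<in> borel_measurable lebesgue" "\<psi> n \<in> borel_measurable lebesgue" for n
    using int by auto
  have [measurable]: "fourier_L1 (\<phi> n) \<in> borel_measurable lebesgue"
      "fourier_L1 (\<psi> n) \<in> borel_measurable lebesgue" for n
    by (rule measurable_completion, simp add: fourier_L1_measurable meas)+
  \<comment> \<open>split \<open>g - g' = (g - \<F> \<phi>\<^sub>n) + \<F> (\<phi>\<^sub>n - \<psi>\<^sub>n) + (\<F> \<psi>\<^sub>n - g')\<close> and use Bessel's inequality
    for the middle term; the summand \<open>0\<close> is an empty slot of the three-term estimate\<close>
  have bound: "(\<integral>\<^sup>+k. ennreal ((cmod (g k - g' k))\<^sup>2) \<partial>lebesgue)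
      \<le> 3 * (C n + 3 * (A n + B n + 0) + D n)" for n
  proof -
    have "(\<integral>\<^sup>+k. ennreal ((cmod (fourier_L1 (\<phi> n) k - fourier_L1 (\<psi> n) k))\<^sup>2) \<partial>lebesgue)
        \<le> (\<integral>\<^sup>+x. ennreal ((cmod (\<phi> n x - \<psi> n x))\<^sup>2) \<partial>lebesgue)"
      using bessel_fourier_L1[of "\<lambda>x. \<phi> n x - \<psi> n x"]
      by (simp add: fourier_L1_diff[OF int] nn_integral_completion)
    also have "\<dots> \<le> 3 * (A n + B n + (\<integral>\<^sup>+x. ennreal ((cmod (0 :: complex))\<^sup>2) \<partial>(lebesgue :: (real^3) measure)))"
      unfolding A_def B_def norm_minus_commute[of "\<psi> n _" "f _"]
      by (rule nn_integral_norm_add3_square_le) auto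
    finally have 1: "(\<integral>\<^sup>+k. ennreal ((cmod (fourier_L1 (\<phi> n) k - fourier_L1 (\<psi> n) k))\<^sup>2) \<partial>lebesgue)
        \<le> 3 * (A n + B n + 0)" by simp
    have "(\<integral>\<^sup>+k. ennreal ((cmod (g k - g' k))\<^sup>2) \<partial>lebesgue)
      \<le> 3 * (C n + (\<integral>\<^sup>+k. ennreal ((cmod (fourier_L1 (\<phi> n) k - fourier_L1 (\<psi> n) k))\<^sup>2) \<partial>lebesgue) + D n)"
      unfolding C_def D_def norm_minus_commute[of "fourier_L1 (\<phi> n) _" "g _"]
      by (rule nn_integral_norm_add3_square_le) auto
    also have "\<dots> \<le> 3 * (C n + 3 * (A n + B n + 0) + D n)"
      by (intro mult_left_mono add_mono order_refl 1) simp
    finally show ?thesis .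
  qed
  have "(\<lambda>n. 3 * (C n + 3 * (A n + B n + 0) + D n)) \<longlonglongrightarrow> 3 * (0 + 3 * (0 + 0 + 0) + 0)"
    by (intro ennreal_tendsto_cmult tendsto_add tendsto_const)
       (simp_all add: A_def B_def C_def D_def \<phi> \<psi>)
  then have "(\<integral>\<^sup>+k. ennreal ((cmod (g k - g' k))\<^sup>2) \<partial>lebesgue) \<le> 3 * (0 + 3 * (0 + 0 + 0) + 0)"
    by (rule LIMSEQ_le_const) (use bound in auto)
  then have "AE k in lebesgue. g k = g' k"
    by (simp add: nn_integral_0_iff_AE)
  then show ?thesis by (simp add: AE_completion_iff)
qed

lemma is_fourier_L2_fourier_L1:
  assumes f: "f \<in> L2_on UNIV" and int: "integrable lebesgue f"
  shows "is_fourier_L2 f (fourier_L1 f)"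
proof -
  have m: "f \<in> borel_measurable lebesgue" using f by (auto simp: L2_on_UNIV_iff)
  have "fourier_L1 f \<in> L2_on UNIV"
    using f fourier_L1_measurable[OF m] bessel_fourier_L1[OF m]
    by (auto simp: L2_on_UNIV_iff intro!: measurable_completion)
  then show ?thesis
    unfolding is_fourier_L2_def using f int by (intro conjI exI[of _ "\<lambda>_. f"]) auto
qed

text \<open>
  In the integrable case the value is the Fourier integral, which is also an \<open>L\<^sup>2\<close> transform
  (approximate by the constant sequence); otherwise it is an arbitrary \<open>L\<^sup>2\<close> transform. Uniqueness
  settles both cases.
\<close>

lemma fourier_eq_AE:
  assumes "is_fourier_L2 f g"
  shows "AE k in lborel. fourier f k = g k"
proof (cases "integrable lebesgue f")
  case True
  then have "is_fourier_L2 f (fourier f)"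
    using assms is_fourier_L2_fourier_L1[of f] by (auto simp: fourier_def is_fourier_L2_def)
  from is_fourier_L2_unique[OF this assms] show ?thesis .
next
  case False
  then have "is_fourier_L2 f (fourier f)"
    using someI[of "is_fourier_L2 f", OF assms] by (simp add: fourier_def)
  from is_fourier_L2_unique[OF this assms] show ?thesis .
qed

section \<open>Fast convergence of frequency cutoffs\<close>

text \<open>
  On a set of finite measure \<open>L\<^sup>2 \<subseteq> L\<^sup>1\<close>, because \<open>|f| \<le> 1 + |f|\<^sup>2\<close>.
\<close>

lemma integrable_of_square_integrable:
  fixes f :: "'a::euclidean_space \<Rightarrow> 'b::{banach, second_countable_topology}"
  assumes [measurable]: "f \<in> borel_measurable borel" and A: "A \<in> sets borel" "emeasure lborel A < \<infinity>"
    and f0: "\<And>x. x \<notin> A \<Longrightarrow> f x = 0"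
    and fin: "(\<integral>\<^sup>+x. ennreal ((norm (f x))\<^sup>2) \<partial>lborel) < \<infinity>"
  shows "integrable lborel f"
proof (rule integrableI_bounded)
  have "(\<integral>\<^sup>+x. ennreal (norm (f x)) \<partial>lborel) \<le> (\<integral>\<^sup>+x. indicator A x + ennreal ((norm (f x))\<^sup>2) \<partial>lborel)"
  proof (intro nn_integral_mono)
    fix x
    have "0 \<le> (norm (f x) - 1 / 2)\<^sup>2" by simp
    then have "norm (f x) \<le> 1 + (norm (f x))\<^sup>2"
      by (simp add: power2_diff power_one_over)
    then have "ennreal (norm (f x)) \<le> 1 + ennreal ((norm (f x))\<^sup>2)"
      by (simp flip: ennreal_1 ennreal_plus)
    then show "ennreal (norm (f x)) \<le> indicator A x + ennreal ((norm (f x))\<^sup>2)"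
      using f0[of x] by (cases "x \<in> A") simp_all
  qed
  also have "\<dots> = emeasure lborel A + (\<integral>\<^sup>+x. ennreal ((norm (f x))\<^sup>2) \<partial>lborel)"
    using A by (subst nn_integral_add) (auto intro!: borel_measurable_indicator)
  also have "\<dots> < \<infinity>" using A fin by simp
  finally show "(\<integral>\<^sup>+x. ennreal (norm (f x)) \<partial>lborel) < \<infinity>" .
qed simp

text \<open>
  By the inequality of the arithmetic and geometric mean, the increments are dominated by
  \<open>2\<^sup>-\<^sup>j + 2\<^sup>j |F\<^sub>j - F\<^sub>j\<^sub>+\<^sub>1|\<^sup>2\<close>, which is summable. This gives pointwise convergence without
  the triangle inequality in \<open>L\<^sup>2\<close>.
\<close>

lemma convergent_of_weighted_squares:
  fixes F :: "nat \<Rightarrow> 'b::banach"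
  assumes "(\<Sum>j. 2 ^ j * ennreal ((norm (F j - F (Suc j)))\<^sup>2)) \<noteq> \<infinity>"
  shows "convergent F"
proof -
  have "(\<Sum>j. ennreal (2 ^ j * (norm (F j - F (Suc j)))\<^sup>2)) \<noteq> \<infinity>"
    using assms by (simp add: ennreal_mult flip: ennreal_power)
  then have s: "summable (\<lambda>j. 2 ^ j * (norm (F j - F (Suc j)))\<^sup>2)"
    by (intro summable_suminf_not_top) auto
  have "summable (\<lambda>j. (1 / 2) ^ j + 2 ^ j * (norm (F j - F (Suc j)))\<^sup>2)"
    by (intro summable_add s summable_geometric) simp
  then have "summable (\<lambda>j. F (Suc j) - F j)"
  proof (rule summable_comparison_test'[where N = 0])
    fix j :: nat
    define d where "d = norm (F j - F (Suc j))"
    \<comment> \<open>the square of \<open>2\<^sup>-\<^sup>j\<^sup>/\<^sup>2 - 2\<^sup>j\<^sup>/\<^sup>2 d\<close>\<close>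
    have "0 \<le> (1 - 2 ^ j * d)\<^sup>2 / 2 ^ j" by simp
    also have "\<dots> = (1 / 2) ^ j - 2 * d + 2 ^ j * d\<^sup>2"
      by (simp add: power2_eq_square field_simps)
    finally have "2 * d \<le> (1 / 2) ^ j + 2 ^ j * d\<^sup>2" by simp
    moreover have "d \<ge> 0" by (simp add: d_def)
    ultimately show "norm (F (Suc j) - F j) \<le> (1 / 2) ^ j + 2 ^ j * (norm (F j - F (Suc j)))\<^sup>2"
      unfolding norm_minus_commute[of "F (Suc j)"] d_def by linarith
  qed
  then have "(\<lambda>n. F 0 + (\<Sum>j<n. F (Suc j) - F j)) \<longlonglongrightarrow> F 0 + (\<Sum>j. F (Suc j) - F j)"
    by (intro tendsto_add tendsto_const summable_LIMSEQ)
  then show ?thesis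
    by (auto simp: sum_lessThan_telescope convergent_def)
qed

lemma tendsto_0_of_weighted_suminf:
  fixes T :: "nat \<Rightarrow> ennreal"
  assumes "(\<Sum>j. 2 ^ j * T j) < \<infinity>"
  shows "T \<longlonglongrightarrow> 0"
proof -
  define t where "t j = enn2real (2 ^ j * T j)" for j
  have "2 ^ j * T j < \<infinity>" for j
    using assms ennreal_suminf_lessD by blast
  then have t: "2 ^ j * T j = ennreal (t j)" for j
    by (simp add: t_def)
  have "summable t"
    using assms unfolding t by (intro summable_suminf_not_top) (auto simp: t_def)
  then have "(\<lambda>j. ennreal (t j)) \<longlonglongrightarrow> ennreal 0"
    by (intro tendsto_ennrealI summable_LIMSEQ_zero)
  then have lim: "(\<lambda>j. ennreal (t j)) \<longlonglongrightarrow> 0" by simp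
  have "T j \<le> ennreal (t j)" for j
  proof -
    have "1 * T j \<le> 2 ^ j * T j"
      by (intro mult_right_mono) (simp_all add: one_le_power)
    then show ?thesis by (simp add: t)
  qed
  then show ?thesis
    by (intro tendsto_sandwich[OF _ _ tendsto_const lim] always_eventually) auto
qed

text \<open>
  A quantitative form of the completeness of \<open>L\<^sup>2\<close>: if the distances decay fast enough, then the
  sequence itself, and not just a subsequence, converges almost everywhere, and the pointwise limit
  is also the limit in \<open>L\<^sup>2\<close>.
\<close>

lemma fast_L2_Cauchy_limit:
  fixes F :: "nat \<Rightarrow> 'a \<Rightarrow> 'b::{banach, second_countable_topology}"
  assumes [measurable]: "\<And>j. F j \<in> borel_measurable M"
    and bound: "\<And>i j. (\<integral>\<^sup>+x. ennreal ((norm (F i x - F j x))\<^sup>2) \<partial>M) \<le> T i + T j"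
    and T: "(\<Sum>j. 2 ^ j * T j) < \<infinity>"
  shows "AE x in M. convergent (\<lambda>j. F j x)"
    and "(\<lambda>j. \<integral>\<^sup>+x. ennreal ((norm (F j x - lim (\<lambda>i. F i x)))\<^sup>2) \<partial>M) \<longlonglongrightarrow> 0"
proof -
  have T2: "(\<Sum>j. 2 ^ j * T j) + (\<Sum>j. 2 ^ j * T j) < \<infinity>"
    using T by simp
  have "(\<integral>\<^sup>+x. (\<Sum>j. 2 ^ j * ennreal ((norm (F j x - F (Suc j) x))\<^sup>2)) \<partial>M)
      = (\<Sum>j. 2 ^ j * (\<integral>\<^sup>+x. ennreal ((norm (F j x - F (Suc j) x))\<^sup>2) \<partial>M))"
    by (simp add: nn_integral_suminf nn_integral_cmult)
  also have "\<dots> \<le> (\<Sum>j. 2 ^ j * T j + 2 ^ Suc j * T (Suc j))"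
  proof (intro suminf_le summableI)
    fix j
    have "2 ^ j * (\<integral>\<^sup>+x. ennreal ((norm (F j x - F (Suc j) x))\<^sup>2) \<partial>M) \<le> 2 ^ j * (T j + T (Suc j))"
      by (intro mult_left_mono bound) simp
    also have "\<dots> \<le> 2 ^ j * T j + 2 ^ Suc j * T (Suc j)"
      unfolding distrib_left by (intro add_mono mult_right_mono power_increasing) simp_all
    finally show "2 ^ j * (\<integral>\<^sup>+x. ennreal ((norm (F j x - F (Suc j) x))\<^sup>2) \<partial>M)
        \<le> 2 ^ j * T j + 2 ^ Suc j * T (Suc j)" .
  qed
  also have "\<dots> = (\<Sum>j. 2 ^ j * T j) + (\<Sum>j. 2 ^ Suc j * T (Suc j))"
    by (intro suminf_add[symmetric] summableI)
  also have "(\<Sum>j. 2 ^ Suc j * T (Suc j)) \<le> (\<Sum>j. 2 ^ j * T j)"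
    using suminf_offset[of "\<lambda>j. 2 ^ j * T j" 1] by (simp add: summableI)
  finally have "(\<integral>\<^sup>+x. (\<Sum>j. 2 ^ j * ennreal ((norm (F j x - F (Suc j) x))\<^sup>2)) \<partial>M)
      \<le> (\<Sum>j. 2 ^ j * T j) + (\<Sum>j. 2 ^ j * T j)"
    by (simp add: add_left_mono)
  then have "(\<integral>\<^sup>+x. (\<Sum>j. 2 ^ j * ennreal ((norm (F j x - F (Suc j) x))\<^sup>2)) \<partial>M) \<noteq> \<infinity>"
    using le_less_trans[OF _ T2] by (auto simp: less_top)
  then have "AE x in M. (\<Sum>j. 2 ^ j * ennreal ((norm (F j x - F (Suc j) x))\<^sup>2)) \<noteq> \<infinity>"
    by (intro nn_integral_PInf_AE) measurable
  then show conv: "AE x in M. convergent (\<lambda>j. F j x)"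
    by eventually_elim (rule convergent_of_weighted_squares)
  have T0: "T \<longlonglongrightarrow> 0" using T by (rule tendsto_0_of_weighted_suminf)
  have "(\<integral>\<^sup>+x. ennreal ((norm (F j x - lim (\<lambda>i. F i x)))\<^sup>2) \<partial>M) \<le> T j + 0" for j
  proof (rule nn_integral_le_tendsto)
    show "AE x in M. (\<lambda>i. ennreal ((norm (F j x - F i x))\<^sup>2))
        \<longlonglongrightarrow> ennreal ((norm (F j x - lim (\<lambda>i. F i x)))\<^sup>2)"
      using conv
    proof eventually_elim
      case (elim x)
      then show ?case
        by (intro tendsto_ennrealI tendsto_power tendsto_norm tendsto_diff tendsto_const)
           (simp add: convergent_LIMSEQ_iff)
    qed
    show "(\<lambda>i. T j + T i) \<longlonglongrightarrow> T j + 0"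
      by (intro tendsto_add tendsto_const T0)
  qed (use bound in auto)
  then show "(\<lambda>j. \<integral>\<^sup>+x. ennreal ((norm (F j x - lim (\<lambda>i. F i x)))\<^sup>2) \<partial>M) \<longlonglongrightarrow> 0"
    by (intro tendsto_sandwich[OF _ _ tendsto_const T0] always_eventually) auto
qed

definition ft_cutoff :: "real \<Rightarrow> ('a::euclidean_space \<Rightarrow> complex) \<Rightarrow> 'a \<Rightarrow> complex" where
  "ft_cutoff r S = ft (\<lambda>k. indicator {..r} (norm k) *\<^sub>R S k)"

text \<open>
  By Bessel's inequality the transforms of two cutoffs differ in squared norm by at most the sum of
  the tails of \<open>S\<close> beyond the two radii, so fast decay of the tails gives almost everywhere convergence.
\<close>

lemma fourier_L2_cutoff_limit:
  fixes S :: "real ^ 3 \<Rightarrow> complex" and r :: "nat \<Rightarrow> real"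
  assumes S [measurable]: "S \<in> borel_measurable borel"
    and fin: "(\<integral>\<^sup>+k. ennreal ((cmod (S k))\<^sup>2) \<partial>lborel) < \<infinity>"
    and T: "(\<Sum>j. 2 ^ j * (\<integral>\<^sup>+k. indicator {r j<..} (norm k) * ennreal ((cmod (S k))\<^sup>2) \<partial>lborel)) < \<infinity>"
  shows "is_fourier_L2 S (\<lambda>x. lim (\<lambda>j. ft_cutoff (r j) S x))"
    and "(\<integral>\<^sup>+x. ennreal ((cmod (lim (\<lambda>j. ft_cutoff (r j) S x)))\<^sup>2) \<partial>lborel)
          \<le> (\<integral>\<^sup>+k. ennreal ((cmod (S k))\<^sup>2) \<partial>lborel)"
proof -
  define Sc where "Sc j k = indicator {..r j} (norm k) *\<^sub>R S k" for j k
  define F where "F j = ft (Sc j)" for j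
  have F: "ft_cutoff (r j) S = F j" for j
    by (simp add: ft_cutoff_def F_def Sc_def[abs_def])
  define U where "U j = (\<integral>\<^sup>+k. indicator {r j<..} (norm k) * ennreal ((cmod (S k))\<^sup>2) \<partial>lborel)" for j
  have U: "(\<Sum>j. 2 ^ j * U j) < \<infinity>" using T by (simp add: U_def)
  have Sc_m [measurable]: "Sc j \<in> borel_measurable borel" for j
    unfolding Sc_def[abs_def] by measurable
  have F_m [measurable]: "F j \<in> borel_measurable borel" for j
    unfolding F_def by measurable
  have Sc_le: "ennreal ((cmod (Sc j k))\<^sup>2) \<le> ennreal ((cmod (S k))\<^sup>2)" for j k
    by (simp add: Sc_def indicator_def)
  have Sc_int: "integrable lborel (Sc j)" for j
  proof (rule integrable_of_square_integrable[where A = "cball 0 (r j)"])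
    show "(\<integral>\<^sup>+k. ennreal ((cmod (Sc j k))\<^sup>2) \<partial>lborel) < \<infinity>"
      using le_less_trans[OF nn_integral_mono[OF Sc_le] fin] .
    show "emeasure lborel (cball (0 :: real ^ 3) (r j)) < \<infinity>"
      by (rule emeasure_bounded_finite[OF bounded_cball])
  qed (auto simp: Sc_def indicator_def)
  have Sc_diff: "(\<integral>\<^sup>+k. ennreal ((cmod (Sc i k - Sc j k))\<^sup>2) \<partial>lborel) \<le> U i + U j" for i j
  proof -
    have "(\<integral>\<^sup>+k. ennreal ((cmod (Sc i k - Sc j k))\<^sup>2) \<partial>lborel)
       \<le> (\<integral>\<^sup>+k. indicator {r i<..} (norm k) * ennreal ((cmod (S k))\<^sup>2)
              + indicator {r j<..} (norm k) * ennreal ((cmod (S k))\<^sup>2) \<partial>lborel)"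
      by (intro nn_integral_mono) (auto simp: Sc_def indicator_def)
    also have "\<dots> = U i + U j" unfolding U_def by (intro nn_integral_add) measurable
    finally show ?thesis .
  qed
  have bound: "(\<integral>\<^sup>+x. ennreal ((cmod (F i x - F j x))\<^sup>2) \<partial>lborel) \<le> U i + U j" for i j
    using order_trans[OF bessel_inequality[of "\<lambda>k. Sc i k - Sc j k"] Sc_diff]
    by (simp add: F_def ft_diff Sc_int)
  have F_m': "F j \<in> borel_measurable lborel" for j by simp
  note lim = fast_L2_Cauchy_limit[OF F_m' bound U]
  define L where "L x = lim (\<lambda>j. F j x)" for x
  have L_m [measurable]: "L \<in> borel_measurable borel" unfolding L_def[abs_def] by measurable
  have L_le: "(\<integral>\<^sup>+x. ennreal ((cmod (L x))\<^sup>2) \<partial>lborel) \<le> (\<integral>\<^sup>+k. ennreal ((cmod (S k))\<^sup>2) \<partial>lborel)"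
  proof (rule nn_integral_le_tendsto)
    show "AE x in lborel. (\<lambda>j. ennreal ((cmod (F j x))\<^sup>2)) \<longlonglongrightarrow> ennreal ((cmod (L x))\<^sup>2)"
      using lim(1)
    proof eventually_elim
      case (elim x)
      then show ?case
        unfolding L_def by (intro tendsto_ennrealI tendsto_power tendsto_norm) (simp add: convergent_LIMSEQ_iff)
    qed
    show "(\<integral>\<^sup>+x. ennreal ((cmod (F j x))\<^sup>2) \<partial>lborel) \<le> (\<integral>\<^sup>+k. ennreal ((cmod (S k))\<^sup>2) \<partial>lborel)" for j
      unfolding F_def
      by (rule order_trans[OF bessel_inequality]) (auto intro!: nn_integral_mono Sc_le)
  qed (auto intro: tendsto_const)
  then show "(\<integral>\<^sup>+x. ennreal ((cmod (lim (\<lambda>j. ft_cutoff (r j) S x)))\<^sup>2) \<partial>lborel)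
          \<le> (\<integral>\<^sup>+k. ennreal ((cmod (S k))\<^sup>2) \<partial>lborel)"
    by (simp add: F L_def)
  have leb: "g \<in> borel_measurable lebesgue" if "g \<in> borel_measurable borel" for g :: "real ^ 3 \<Rightarrow> complex"
    using that by (intro measurable_completion) simp
  have "is_fourier_L2 S L"
    unfolding is_fourier_L2_def
  proof (intro conjI exI[of _ Sc] allI)
    show "S \<in> L2_on UNIV" using fin by (simp add: L2_on_UNIV_iff leb)
    show "L \<in> L2_on UNIV" using fin L_le by (auto simp: L2_on_UNIV_iff leb)
    show "integrable lebesgue (Sc j)" for j using Sc_int by (simp add: integrable_completion)
    show "Sc j \<in> L2_on UNIV" for j
      using fin le_less_trans[OF nn_integral_mono[OF Sc_le]] by (auto simp: L2_on_UNIV_iff leb)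
    have "(\<integral>\<^sup>+k. ennreal ((cmod (Sc j k - S k))\<^sup>2) \<partial>lborel) = U j" for j
      unfolding U_def by (intro nn_integral_cong) (auto simp: Sc_def indicator_def)
    then show "(\<lambda>j. \<integral>\<^sup>+k. ennreal ((cmod (Sc j k - S k))\<^sup>2) \<partial>lebesgue) \<longlonglongrightarrow> 0"
      using tendsto_0_of_weighted_suminf[OF U] by (simp add: nn_integral_completion)
    show "(\<lambda>j. \<integral>\<^sup>+x. ennreal ((cmod (fourier_L1 (Sc j) x - L x))\<^sup>2) \<partial>lebesgue) \<longlonglongrightarrow> 0"
      using lim(2) by (simp add: nn_integral_completion fourier_L1_borel F_def L_def)
  qed
  then show "is_fourier_L2 S (\<lambda>x. lim (\<lambda>j. ft_cutoff (r j) S x))"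
    by (simp add: F L_def[abs_def])
qed

text \<open>
  The radius \<open>r\<^sub>j\<close> is chosen so that the part of \<open>G\<close> beyond it has total mass below \<open>4\<^sup>-\<^sup>j\<close>. The
  weighted sum over \<open>j\<close> then has a finite integral over \<open>s\<close>, hence is finite for almost every \<open>s\<close>,
  although the radii do not depend on \<open>s\<close>.
\<close>

lemma fast_cutoff_radii:
  fixes G :: "real \<times> 'a::euclidean_space \<Rightarrow> ennreal"
  assumes [measurable]: "G \<in> borel_measurable borel"
    and fin: "(\<integral>\<^sup>+s. (\<integral>\<^sup>+k. G (s, k) \<partial>lborel) \<partial>lborel) < \<infinity>"
  obtains r :: "nat \<Rightarrow> real" where
    "AE s in lborel. (\<Sum>j. 2 ^ j * (\<integral>\<^sup>+k. indicator {r j<..} (norm k) * G (s, k) \<partial>lborel)) < \<infinity>"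
proof -
  have fin': "(\<integral>\<^sup>+p. G p \<partial>(lborel \<Otimes>\<^sub>M lborel)) < \<infinity>"
    using fin by (subst lborel.nn_integral_fst[symmetric]) (auto simp: lborel_prod)
  define V where "V n = (\<integral>\<^sup>+p. indicator {real n<..} (norm (snd p)) * G p \<partial>(lborel \<Otimes>\<^sub>M lborel))" for n
  have "V \<longlonglongrightarrow> (\<integral>\<^sup>+p. 0 \<partial>((lborel :: real measure) \<Otimes>\<^sub>M (lborel :: 'a measure)))"
    unfolding V_def
  proof (rule nn_integral_dominated_convergence[where w = G])
    show "AE p in lborel \<Otimes>\<^sub>M lborel. (\<lambda>n. indicator {real n<..} (norm (snd p)) * G p) \<longlonglongrightarrow> 0"
    proof (rule AE_I2)
      fix p :: "real \<times> 'a"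
      obtain N :: nat where N: "norm (snd p) \<le> real N" using real_arch_simple by blast
      have "eventually (\<lambda>n. indicator {real n<..} (norm (snd p)) * G p = 0) sequentially"
        using eventually_ge_at_top[of N]
      proof eventually_elim
        case (elim n)
        then have "norm (snd p) \<le> real n" using N by linarith
        then show ?case by simp
      qed
      then show "(\<lambda>n. indicator {real n<..} (norm (snd p)) * G p) \<longlonglongrightarrow> 0"
        by (rule tendsto_eventually)
    qed
    show "AE p in lborel \<Otimes>\<^sub>M lborel. indicator {real n<..} (norm (snd p)) * G p \<le> G p" for n
      by (intro AE_I2) (auto simp: indicator_def)
  qed (use fin' in \<open>auto simp: lborel_prod\<close>)
  then have V0: "V \<longlonglongrightarrow> 0" by simp
  have "\<exists>n. V n < ennreal ((1 / 4) ^ j)" for j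
  proof -
    have "eventually (\<lambda>n. V n < ennreal ((1 / 4) ^ j)) sequentially"
      by (rule order_tendstoD(2)[OF V0]) simp
    then show ?thesis by (auto dest: eventually_happens)
  qed
  then obtain n where n: "\<And>j. V (n j) < ennreal ((1 / 4) ^ j)" by metis
  have m [measurable]: "(\<lambda>s. \<integral>\<^sup>+k. indicator {real (n j)<..} (norm k) * G (s, k) \<partial>lborel) \<in> borel_measurable borel" for j
  proof -
    have "(\<lambda>p. indicator {real (n j)<..} (norm (snd p)) * G p) \<in> borel_measurable (borel \<Otimes>\<^sub>M lborel)"
      by (rule borel_measurable_pair_lborel) measurable
    from lborel.borel_measurable_nn_integral_fst[OF this] show ?thesis by simp
  qed
  have "(\<integral>\<^sup>+s. (\<Sum>j. 2 ^ j * (\<integral>\<^sup>+k. indicator {real (n j)<..} (norm k) * G (s, k) \<partial>lborel)) \<partial>lborel)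
      = (\<Sum>j. 2 ^ j * V (n j))"
  proof -
    have "(\<integral>\<^sup>+s. (\<integral>\<^sup>+k. indicator {real (n j)<..} (norm k) * G (s, k) \<partial>lborel) \<partial>lborel) = V (n j)" for j
      unfolding V_def by (subst lborel.nn_integral_fst[symmetric]) (auto simp: lborel_prod)
    then show ?thesis by (simp add: nn_integral_suminf nn_integral_cmult)
  qed
  also have "\<dots> \<le> (\<Sum>j. ennreal ((1 / 2) ^ j))"
  proof (intro suminf_le summableI)
    fix j
    have "2 ^ j * V (n j) \<le> ennreal (2 ^ j) * ennreal ((1 / 4) ^ j)"
      using n[of j] by (intro mult_mono) (auto simp flip: ennreal_power)
    also have "\<dots> = ennreal ((1 / 2) ^ j)"
      by (simp flip: ennreal_mult power_mult_distrib)
    finally show "2 ^ j * V (n j) \<le> ennreal ((1 / 2) ^ j)" .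
  qed
  also have "\<dots> < \<infinity>"
    by (simp add: suminf_ennreal_eq[OF _ summable_sums[OF summable_geometric]] del: ennreal_power)
  finally have "AE s in lborel. (\<Sum>j. 2 ^ j * (\<integral>\<^sup>+k. indicator {real (n j)<..} (norm k) * G (s, k) \<partial>lborel)) \<noteq> \<infinity>"
    by (intro nn_integral_PInf_AE) auto
  then show thesis
    by (intro that[of "\<lambda>j. real (n j)"]) (auto simp: less_top)
qed

text \<open>
  A jointly measurable version of a family of \<open>L\<^sup>2\<close> transforms. The parameter \<open>p\<close> is meant to be a
  pair of times \<open>(t, s)\<close>; the dominating function depends on it only through the coordinate
  \<open>\<tau> p = s\<close>, and therefore the exceptional null set can be chosen in that coordinate alone.
\<close>

lemma fourier_L2_parametrized:
  fixes S :: "'p::{second_countable_topology, t2_space} \<times> (real ^ 3) \<Rightarrow> complex" and G :: "real \<times> (real ^ 3) \<Rightarrow> ennreal"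
    and \<tau> :: "'p \<Rightarrow> real"
  assumes [measurable]: "S \<in> borel_measurable borel" "G \<in> borel_measurable borel"
    and le: "\<And>p k. ennreal ((cmod (S (p, k)))\<^sup>2) \<le> G (\<tau> p, k)"
    and fin: "(\<integral>\<^sup>+s. (\<integral>\<^sup>+k. G (s, k) \<partial>lborel) \<partial>lborel) < \<infinity>"
  obtains h :: "(real ^ 3) \<times> 'p \<Rightarrow> complex" where
    "h \<in> borel_measurable borel"
    "AE s in lborel. \<forall>p. \<tau> p = s \<longrightarrow> is_fourier_L2 (\<lambda>k. S (p, k)) (\<lambda>x. h (x, p)) \<and>
       (\<integral>\<^sup>+x. ennreal ((cmod (h (x, p)))\<^sup>2) \<partial>lborel) \<le> (\<integral>\<^sup>+k. G (s, k) \<partial>lborel)"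
proof -
  obtain r where r: "AE s in lborel. (\<Sum>j. 2 ^ j * (\<integral>\<^sup>+k. indicator {r j<..} (norm k) * G (s, k) \<partial>lborel)) < \<infinity>"
    using fast_cutoff_radii[of G] fin by auto
  define h where "h = (\<lambda>(x, p). lim (\<lambda>j. ft_cutoff (r j) (\<lambda>k. S (p, k)) x))"
  show thesis
  proof
    have "(\<lambda>q. ft (\<lambda>k. indicator {..r j} (norm k) *\<^sub>R S (snd q, k)) (fst q)) \<in> borel_measurable (borel \<Otimes>\<^sub>M borel)" for j
      by measurable
    then have [measurable]: "(\<lambda>q. ft_cutoff (r j) (\<lambda>k. S (snd q, k)) (fst q)) \<in> borel_measurable borel" for j
      by (simp add: ft_cutoff_def borel_prod)
    show "h \<in> borel_measurable borel"
      unfolding h_def split_beta' by measurable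
    have "AE s in lborel. (\<integral>\<^sup>+k. G (s, k) \<partial>lborel) \<noteq> \<infinity>"
    proof (rule nn_integral_PInf_AE)
      have "G \<in> borel_measurable (borel \<Otimes>\<^sub>M lborel)"
        by (rule borel_measurable_pair_lborel) measurable
      from lborel.borel_measurable_nn_integral_fst[OF this]
      show "(\<lambda>s. \<integral>\<^sup>+k. G (s, k) \<partial>lborel) \<in> borel_measurable lborel" by simp
    qed (use fin in auto)
    with r show "AE s in lborel. \<forall>p. \<tau> p = s \<longrightarrow> is_fourier_L2 (\<lambda>k. S (p, k)) (\<lambda>x. h (x, p)) \<and>
       (\<integral>\<^sup>+x. ennreal ((cmod (h (x, p)))\<^sup>2) \<partial>lborel) \<le> (\<integral>\<^sup>+k. G (s, k) \<partial>lborel)"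
    proof (eventually_elim, intro allI impI)
      fix s p assume s: "(\<Sum>j. 2 ^ j * (\<integral>\<^sup>+k. indicator {r j<..} (norm k) * G (s, k) \<partial>lborel)) < \<infinity>"
        "(\<integral>\<^sup>+k. G (s, k) \<partial>lborel) \<noteq> \<infinity>" and p: "\<tau> p = s"
      have le': "ennreal ((cmod (S (p, k)))\<^sup>2) \<le> G (s, k)" for k using le[of p k] p by simp
      have 1: "(\<integral>\<^sup>+k. ennreal ((cmod (S (p, k)))\<^sup>2) \<partial>lborel) \<le> (\<integral>\<^sup>+k. G (s, k) \<partial>lborel)"
        by (intro nn_integral_mono le')
      have 2: "(\<integral>\<^sup>+k. ennreal ((cmod (S (p, k)))\<^sup>2) \<partial>lborel) < \<infinity>"
        using 1 s(2) by (simp add: less_top le_less_trans)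
      have 3: "(\<Sum>j. 2 ^ j * (\<integral>\<^sup>+k. indicator {r j<..} (norm k) * ennreal ((cmod (S (p, k)))\<^sup>2) \<partial>lborel)) < \<infinity>"
        by (rule le_less_trans[OF _ s(1)])
           (intro suminf_le summableI mult_left_mono nn_integral_mono le'; simp)
      have 4: "(\<lambda>k. S (p, k)) \<in> borel_measurable borel" by measurable
      show "is_fourier_L2 (\<lambda>k. S (p, k)) (\<lambda>x. h (x, p)) \<and>
       (\<integral>\<^sup>+x. ennreal ((cmod (h (x, p)))\<^sup>2) \<partial>lborel) \<le> (\<integral>\<^sup>+k. G (s, k) \<partial>lborel)"
        using fourier_L2_cutoff_limit[OF 4 2 3] 1 by (auto simp: h_def)
    qed
  qed
qed

section \<open>Tonelli's theorem for Lebesgue measure on product spaces\<close>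

lemma AE_lborel_prod_iterated:
  fixes P :: "'a::euclidean_space \<times> 'b::euclidean_space \<Rightarrow> bool"
  assumes "AE z in lborel. P z"
  shows "AE x in lborel. AE y in lborel. P (x, y)"
  using assms by (intro lborel_pair.AE_pair) (subst lborel_prod)

lemma nn_integral_lborel_iterated:
  fixes f :: "'a::euclidean_space \<times> 'b::euclidean_space \<Rightarrow> ennreal"
  assumes "f \<in> borel_measurable borel"
  shows "(\<integral>\<^sup>+x. (\<integral>\<^sup>+y. f (x, y) \<partial>lborel) \<partial>lborel) = (\<integral>\<^sup>+z. f z \<partial>lborel)"
    and "(\<integral>\<^sup>+y. (\<integral>\<^sup>+x. f (x, y) \<partial>lborel) \<partial>lborel) = (\<integral>\<^sup>+z. f z \<partial>lborel)"
  using assms lborel.nn_integral_fst[of f lborel] lborel_pair.nn_integral_snd[of f]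
  by (simp_all add: lborel_prod)

text \<open>
  The integrand depends on \<open>(x, (t, s))\<close>, while its time integral is a function of \<open>(x, t)\<close>; the next
  two lemmas pass from one grouping to the other.
\<close>

lemma nn_integral_lborel_regroup:
  fixes f :: "'a::euclidean_space \<times> 'b::euclidean_space \<times> 'c::euclidean_space \<Rightarrow> ennreal"
  assumes [measurable]: "f \<in> borel_measurable borel"
  shows "(\<integral>\<^sup>+(x, y). (\<integral>\<^sup>+z. f (x, y, z) \<partial>lborel) \<partial>lborel) = (\<integral>\<^sup>+p. f p \<partial>lborel)"
proof -
  have [measurable]: "(\<lambda>q. \<integral>\<^sup>+z. f (fst q, snd q, z) \<partial>lborel) \<in> borel_measurable borel"
  proof -
    have "(\<lambda>(q, z). f (fst q, snd q, z)) \<in> borel_measurable (borel \<Otimes>\<^sub>M lborel)"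
      by (rule borel_measurable_pair_lborel) (unfold split_beta', measurable)
    from lborel.borel_measurable_nn_integral_fst[OF this] show ?thesis by simp
  qed
  have "(\<integral>\<^sup>+(x, y). (\<integral>\<^sup>+z. f (x, y, z) \<partial>lborel) \<partial>lborel)
      = (\<integral>\<^sup>+x. (\<integral>\<^sup>+y. (\<integral>\<^sup>+z. f (x, y, z) \<partial>lborel) \<partial>lborel) \<partial>lborel)"
    using nn_integral_lborel_iterated(1)[of "\<lambda>q. \<integral>\<^sup>+z. f (fst q, snd q, z) \<partial>lborel"]
    by (simp add: split_beta')
  also have "\<dots> = (\<integral>\<^sup>+x. (\<integral>\<^sup>+q. f (x, q) \<partial>lborel) \<partial>lborel)"
    by (intro nn_integral_cong nn_integral_lborel_iterated(1)) measurable
  also have "\<dots> = (\<integral>\<^sup>+p. f p \<partial>lborel)"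
    by (rule nn_integral_lborel_iterated) measurable
  finally show ?thesis .
qed

lemma AE_lborel_regroup:
  fixes P :: "'a::euclidean_space \<times> 'b::euclidean_space \<times> 'c::euclidean_space \<Rightarrow> bool"
  assumes "AE p in lborel. P p"
  shows "AE (x, y) in lborel. AE z in lborel. P (x, y, z)"
proof -
  obtain N where N: "{p. \<not> P p} \<subseteq> N" "N \<in> null_sets lborel"
    using assms by (auto elim!: AE_E simp: null_sets_def)
  then have [measurable]: "N \<in> sets borel" by auto
  define g where "g q = (\<integral>\<^sup>+z. indicator N (fst q, snd q, z) \<partial>lborel)" for q :: "'a \<times> 'b"
  have m: "(\<lambda>(q, z). indicator N (fst q, snd q, z) :: ennreal) \<in> borel_measurable (borel \<Otimes>\<^sub>M lborel)"
    by (rule borel_measurable_pair_lborel) (unfold split_beta', measurable)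
  have g: "g \<in> borel_measurable lborel"
    using lborel.borel_measurable_nn_integral_fst[OF m] by (simp add: g_def[abs_def])
  have "(\<integral>\<^sup>+q. g q \<partial>lborel) = (\<integral>\<^sup>+p. indicator N p \<partial>lborel)"
    using nn_integral_lborel_regroup[of "indicator N"] by (simp add: split_beta' g_def)
  also have "\<dots> = 0" using N by (simp add: null_setsD1)
  finally have "AE q in lborel. g q = 0"
    by (simp add: nn_integral_0_iff_AE[OF g])
  then show ?thesis
  proof eventually_elim
    case (elim q)
    then have "AE z in lborel. indicator N (fst q, snd q, z) = (0::ennreal)"
      unfolding g_def by (subst (asm) nn_integral_0_iff_AE) auto
    then have "AE z in lborel. P (fst q, snd q, z)"
      by eventually_elim (use N in \<open>auto simp: indicator_eq_0_iff\<close>)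
    then show ?case by (simp add: split_beta')
  qed
qed

lemma AE_lborel_prod_iterated_swap:
  fixes P :: "'a::euclidean_space \<times> 'b::euclidean_space \<Rightarrow> bool"
  assumes "AE z in lborel. P z"
  shows "AE y in lborel. AE x in lborel. P (x, y)"
proof -
  obtain N where N: "{p. \<not> P p} \<subseteq> N" "N \<in> null_sets lborel"
    using assms by (auto elim!: AE_E simp: null_sets_def)
  then have [measurable]: "N \<in> sets borel" by auto
  have N': "{z. z \<notin> N} \<in> sets (borel \<Otimes>\<^sub>M borel)"
    unfolding borel_prod by measurable
  have "AE z in lborel. z \<notin> N" using N by (intro AE_not_in)
  then have "AE x in lborel. AE y in lborel. (x, y) \<notin> N" by (rule AE_lborel_prod_iterated)
  then have "AE y in lborel. AE x in lborel. (x, y) \<notin> N"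
    by (subst (asm) lborel_pair.AE_commute) (simp_all add: N' space_pair_measure)
  then show ?thesis
    by (elim eventually_mono) (use N in auto)
qed

text \<open>
  The set need only be Lebesgue measurable: it differs from a Borel set by a null set, and the Borel
  set is null by Tonelli's theorem. Without measurability the conclusion would fail, which is why
  versions of the integrand are required to be jointly measurable.
\<close>

lemma AE_lborel_prodI:
  fixes P :: "'a::euclidean_space \<times> 'b::euclidean_space \<Rightarrow> bool"
  assumes P: "{z. \<not> P z} \<in> sets lebesgue" and ae: "AE y in lborel. AE x in lborel. P (x, y)"
  shows "AE z in lborel. P z"
proof -
  obtain B N N' where B: "{z. \<not> P z} = B \<union> N" "N \<subseteq> N'" "N' \<in> null_sets lborel" "B \<in> sets lborel"
    using P by (rule sets_completionE)
  have [measurable]: "B \<in> sets borel" using B by simp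
  have B': "{z. z \<notin> B} \<in> sets (borel \<Otimes>\<^sub>M borel)"
    unfolding borel_prod by measurable
  have "AE y in lborel. AE x in lborel. (x, y) \<notin> B"
    using ae by (elim eventually_mono) (use B in auto)
  then have "AE x in lborel. AE y in lborel. (x, y) \<notin> B"
    by (subst lborel_pair.AE_commute) (simp_all add: B' space_pair_measure)
  then have "AE z in lborel \<Otimes>\<^sub>M lborel. z \<notin> B"
    by (intro lborel_pair.AE_pair_measure) (simp_all add: B' space_pair_measure)
  then have "AE z in lborel. z \<notin> B" by (subst (asm) lborel_prod)
  moreover have "AE z in lborel. z \<notin> N'" using B by (intro AE_not_in)
  ultimately show ?thesis by eventually_elim (use B in auto)
qed

lemma AE_lborel_snd:
  assumes "AE y in (lborel :: 'b::euclidean_space measure). P y"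
  shows "AE z in (lborel :: ('a::euclidean_space \<times> 'b) measure). P (snd z)"
proof -
  obtain N where N: "{p. \<not> P p} \<subseteq> N" "N \<in> null_sets lborel"
    using assms by (auto elim!: AE_E simp: null_sets_def)
  then have [measurable]: "N \<in> sets borel" by auto
  have "AE z in (lborel :: ('a \<times> 'b) measure). snd z \<notin> N"
  proof (rule AE_lborel_prodI)
    have "{z :: 'a \<times> 'b. snd z \<in> N} \<in> sets borel" by measurable
    then show "{z :: 'a \<times> 'b. \<not> snd z \<notin> N} \<in> sets lebesgue" by auto
    show "AE y in lborel. AE x :: 'a in lborel. snd (x, y) \<notin> N"
      using AE_not_in[OF N(2)] by (elim eventually_mono) simp
  qed
  then show ?thesis by (elim eventually_mono) (use N in auto)
qed

lemma lborel_distr_uminus_euclidean: "distr lborel borel uminus = (lborel :: 'a::euclidean_space measure)"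
  using lborel_affine[of "-1" "0::'a"] by (simp add: density_1)

lemma AE_lborel_uminus:
  fixes P :: "'a::euclidean_space \<Rightarrow> bool"
  assumes "AE x in lborel. P x"
  shows "AE x in lborel. P (- x)"
proof -
  have "AE x in distr lborel borel (\<lambda>x::'a. - x). P x"
    using lborel_distr_uminus_euclidean assms by (rule ssubst)
  then show ?thesis by (rule AE_distrD[rotated]) measurable
qed

lemma nn_integral_lborel_uminus:
  fixes f :: "'a::euclidean_space \<Rightarrow> ennreal"
  assumes "f \<in> borel_measurable borel"
  shows "(\<integral>\<^sup>+x. f (- x) \<partial>lborel) = (\<integral>\<^sup>+x. f x \<partial>lborel)"
  using nn_integral_distr[of uminus lborel borel f] assms by (simp add: lborel_distr_uminus_euclidean)

section \<open>Components of biquaternion products\<close>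

lemma biquat_index_cases: "i = 0 \<or> i = 1 \<or> i = 2 \<or> i = (3::4)"
proof -
  have "(0::4) = 4" by simp
  then show ?thesis using exhaust_4[of i] by metis
qed

lemma norm_bq_times_nth_le:
  assumes p: "\<And>i. cmod (p $ i) \<le> 1"
  shows "cmod ((p \<odot> q) $ j) \<le> 4 * norm q"
proof -
  have pq: "cmod (p $ i * q $ l) \<le> norm q" for i l
    using mult_mono[OF p[of i] Finite_Cartesian_Product.norm_nth_le[of q l]] by (simp add: norm_mult)
  have *: "cmod (a + b + c + d) \<le> 4 * norm q" if "cmod a \<le> norm q" "cmod b \<le> norm q" "cmod c \<le> norm q" "cmod d \<le> norm q" for a b c d
    using norm_triangle_ineq[of "a + b + c" d] norm_triangle_ineq[of "a + b" c] norm_triangle_ineq[of a b] that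
    by linarith
  have **: "cmod (- (p $ i * q $ l)) \<le> norm q" for i l using pq[of i l] by simp
  show ?thesis
    using biquat_index_cases[of j] unfolding bq_times_def diff_conv_add_uminus
    by (elim disjE) (simp_all only: bq_nth, (intro * pq **)+)
qed

lemma norm_quat_exp_nth_le:
  assumes "\<sigma> \<in> {1, -1}"
  shows "cmod (quat_exp \<sigma> k \<tau> $ j) \<le> 1"
proof -
  define a where "a = 2 * pi * norm k * \<tau>"
  have s: "cmod (- ((\<sigma> * sin a) *\<^sub>R complex_of_real (k $ i / norm k))) \<le> 1" for i
  proof -
    have "\<bar>k $ i / norm k\<bar> \<le> 1"
      using component_le_norm_cart[of k i] by (simp add: divide_le_eq_1)
    moreover have "\<bar>\<sigma> * sin a\<bar> \<le> 1" using assms by (auto simp: abs_mult)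
    ultimately have "\<bar>\<sigma> * sin a\<bar> * \<bar>k $ i / norm k\<bar> \<le> 1 * 1"
      by (intro mult_mono) auto
    then show ?thesis by (simp only: norm_minus_cancel norm_scaleR norm_of_real mult_1)
  qed
  have "quat_exp \<sigma> k \<tau> $ 0 = of_real (cos a)"
    and "quat_exp \<sigma> k \<tau> $ 1 = - ((\<sigma> * sin a) *\<^sub>R complex_of_real (k $ 1 / norm k))"
    and "quat_exp \<sigma> k \<tau> $ 2 = - ((\<sigma> * sin a) *\<^sub>R complex_of_real (k $ 2 / norm k))"
    and "quat_exp \<sigma> k \<tau> $ 3 = - ((\<sigma> * sin a) *\<^sub>R complex_of_real (k $ 3 / norm k))"
    by (simp_all add: quat_exp_def quat_of_vec_def a_def divide_inverse mult.commute)
  with biquat_index_cases[of j] s show ?thesis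
    by (elim disjE) (simp_all only:, simp)
qed

section \<open>Versions of the integrand of the Teodorescu transform\<close>

text \<open>
  The representatives are made to vanish outside the cylinder exactly, and not just almost
  everywhere, so that every time slice has support in the bounded set \<open>\<Omega>\<close>.
\<close>

lemma cylinder_borel_rep:
  assumes \<Omega>: "open \<Omega>" and w: "w \<in> bq_L2_on (cylinder \<Omega>)"
  obtains W :: "4 \<Rightarrow> (real ^ 3) \<times> real \<Rightarrow> complex" where
    "\<And>i. W i \<in> borel_measurable borel"
    "\<And>i p. p \<notin> cylinder \<Omega> \<Longrightarrow> W i p = 0"
    "AE p in lborel. \<forall>i. zero_ext (cylinder \<Omega>) w p $ i = W i p"
    "\<And>i. (\<integral>\<^sup>+p. ennreal ((cmod (W i p))\<^sup>2) \<partial>lborel) < \<infinity>"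
proof -
  define C where "C = cylinder \<Omega>"
  have C [measurable]: "C \<in> sets borel"
    using \<Omega> unfolding C_def cylinder_def by (intro borel_open open_Times) auto
  then have C': "C \<in> sets lebesgue" by (auto intro: sets_completionI_sets)
  define rep where "rep i g \<longleftrightarrow> g \<in> borel_measurable borel \<and> (\<forall>p. p \<notin> C \<longrightarrow> g p = 0) \<and>
      (AE p in lborel. zero_ext C w p $ i = g p) \<and>
      (\<integral>\<^sup>+p. ennreal ((cmod (g p))\<^sup>2) \<partial>lborel) < \<infinity>" for i g
  have "\<exists>g. rep i g" for i
  proof -
    have wi: "(\<lambda>p. w p $ i) \<in> borel_measurable (lebesgue_on C)"
      "integrable (lebesgue_on C) (\<lambda>p. (cmod (w p $ i))\<^sup>2)"
      using w by (auto simp: bq_L2_on_def L2_on_def C_def)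
    have ext: "(\<lambda>p. if p \<in> C then w p $ i else 0) = (\<lambda>p. zero_ext C w p $ i)"
      by (auto simp: zero_ext_def)
    have "(\<lambda>p. zero_ext C w p $ i) \<in> borel_measurable lebesgue"
      using borel_measurable_if_I[OF wi(1) C'] unfolding ext .
    then obtain g where g [measurable]: "g \<in> borel_measurable borel"
      and eq: "AE p in lborel. zero_ext C w p $ i = g p"
      by (rule lebesgue_measurable_borel_rep)
    \<comment> \<open>\<open>g\<close> agrees with the extension by zero only almost everywhere, hence the truncation\<close>
    define g' where "g' p = (if p \<in> C then g p else 0)" for p
    have eq': "AE p in lborel. zero_ext C w p $ i = g' p"
      using eq by eventually_elim (auto simp: g'_def zero_ext_def)
    have "(\<integral>\<^sup>+p. ennreal ((cmod (g' p))\<^sup>2) \<partial>lborel)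
        = (\<integral>\<^sup>+p. ennreal ((cmod (w p $ i))\<^sup>2) * indicator C p \<partial>lborel)"
      using eq' by (intro nn_integral_cong_AE) (auto elim!: eventually_mono simp: zero_ext_def indicator_def)
    also have "\<dots> = (\<integral>\<^sup>+p. ennreal ((cmod (w p $ i))\<^sup>2) \<partial>lebesgue_on C)"
      using C' by (subst nn_integral_restrict_space) (simp_all add: nn_integral_completion)
    also have "\<dots> < \<infinity>"
      using wi(2) by (simp add: integrable_iff_bounded)
    finally show ?thesis
      using eq' unfolding rep_def by (intro exI[of _ g']) (auto simp: g'_def[abs_def])
  qed
  then obtain W where W: "\<And>i. rep i (W i)" by metis
  show thesis
    by (rule that[of W]) (use W in \<open>auto simp: rep_def C_def AE_all_countable\<close>)
qed

text \<open>
  The Fourier transform of a time slice, computed from Borel representatives of the four components.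
\<close>

definition slice_ft :: "(4 \<Rightarrow> (real ^ 3) \<times> real \<Rightarrow> complex) \<Rightarrow> real \<Rightarrow> real ^ 3 \<Rightarrow> biquat" where
  "slice_ft W s k = (\<chi> i. ft (\<lambda>x. W i (x, s)) k)"

lemma zero_ext_AE_cong:
  assumes \<Omega>: "open \<Omega>" and ae: "AE p in lebesgue_on (cylinder \<Omega>). w' p = w p"
  shows "AE p in lborel. zero_ext (cylinder \<Omega>) w' p = zero_ext (cylinder \<Omega>) w p"
proof -
  have "cylinder \<Omega> \<in> sets borel"
    using \<Omega> unfolding cylinder_def by (intro borel_open open_Times) auto
  then have "cylinder \<Omega> \<inter> space lebesgue \<in> sets (lebesgue :: ((real ^ 3) \<times> real) measure)"
    by (auto intro: sets_completionI_sets)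
  then have "AE p in lborel. p \<in> cylinder \<Omega> \<longrightarrow> w' p = w p"
    using ae by (simp add: AE_restrict_space_iff AE_completion_iff)
  then show ?thesis by eventually_elim (auto simp: zero_ext_def)
qed

lemma slices_square_integrable:
  fixes W :: "4 \<Rightarrow> (real ^ 3) \<times> real \<Rightarrow> complex"
  assumes \<Omega>: "open \<Omega>" "bounded \<Omega>"
    and W [measurable]: "\<And>i. W i \<in> borel_measurable borel"
    and W0: "\<And>i p. p \<notin> cylinder \<Omega> \<Longrightarrow> W i p = 0"
    and fin: "\<And>i. (\<integral>\<^sup>+p. ennreal ((cmod (W i p))\<^sup>2) \<partial>lborel) < \<infinity>"
  shows "AE s in lborel. \<forall>i. integrable lborel (\<lambda>x. W i (x, s)) \<and>
           (\<integral>\<^sup>+x. ennreal ((cmod (W i (x, s)))\<^sup>2) \<partial>lborel) < \<infinity>"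
proof -
  have "AE s in lborel. (\<integral>\<^sup>+x. ennreal ((cmod (W i (x, s)))\<^sup>2) \<partial>lborel) \<noteq> \<infinity>" for i
  proof (rule nn_integral_PInf_AE)
    show "(\<integral>\<^sup>+s. (\<integral>\<^sup>+x. ennreal ((cmod (W i (x, s)))\<^sup>2) \<partial>lborel) \<partial>lborel) \<noteq> \<infinity>"
      using fin[of i] by (subst nn_integral_lborel_iterated(2)) auto
    have "(\<lambda>(s, x). ennreal ((cmod (W i (x, s)))\<^sup>2)) \<in> borel_measurable (borel \<Otimes>\<^sub>M lborel)"
      by (rule borel_measurable_pair_lborel) (unfold split_beta', measurable)
    from lborel.borel_measurable_nn_integral_fst[OF this]
    show "(\<lambda>s. \<integral>\<^sup>+x. ennreal ((cmod (W i (x, s)))\<^sup>2) \<partial>lborel) \<in> borel_measurable lborel" by simp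
  qed
  then have "AE s in lborel. \<forall>i. (\<integral>\<^sup>+x. ennreal ((cmod (W i (x, s)))\<^sup>2) \<partial>lborel) \<noteq> \<infinity>"
    by (simp add: AE_all_countable)
  then show ?thesis
  proof (eventually_elim, intro allI)
    fix s i assume "\<forall>i. (\<integral>\<^sup>+x. ennreal ((cmod (W i (x, s)))\<^sup>2) \<partial>lborel) \<noteq> \<infinity>"
    then have f: "(\<integral>\<^sup>+x. ennreal ((cmod (W i (x, s)))\<^sup>2) \<partial>lborel) < \<infinity>"
      by (auto simp: less_top)
    have "integrable lborel (\<lambda>x. W i (x, s))"
      by (rule integrable_of_square_integrable[where A = \<Omega>])
         (use \<Omega> W0 f emeasure_bounded_finite[of \<Omega>] in \<open>auto simp: cylinder_def\<close>)
    with f show "integrable lborel (\<lambda>x. W i (x, s)) \<and>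
        (\<integral>\<^sup>+x. ennreal ((cmod (W i (x, s)))\<^sup>2) \<partial>lborel) < \<infinity>" by simp
  qed
qed

text \<open>
  An exact equality of functions of \<open>k\<close>: for an integrable slice the transform is an integral, which
  does not change if the slice is altered on a null set. For this reason two representatives of \<open>w\<close>
  have the same spectrum for almost every \<open>s\<close>.
\<close>

lemma teodorescu_spectrum_eq:
  assumes int: "\<And>i. integrable lborel (\<lambda>x. W i (x, s))"
    and ae: "AE x in lborel. \<forall>i. zero_ext (cylinder \<Omega>) w (x, s) $ i = W i (x, s)"
  shows "teodorescu_spectrum \<Omega> \<sigma> w t s = (\<lambda>k. quat_exp \<sigma> k (t - s) \<odot> slice_ft W s k)"
proof -
  have "fourier (\<lambda>x. zero_ext (cylinder \<Omega>) w (x, s) $ i) = ft (\<lambda>x. W i (x, s))" for i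
  proof -
    have ae': "AE x in lborel. zero_ext (cylinder \<Omega>) w (x, s) $ i = W i (x, s)"
      using ae by eventually_elim simp
    then have ae'': "AE x in lborel. W i (x, s) = zero_ext (cylinder \<Omega>) w (x, s) $ i"
      by eventually_elim simp
    have m: "(\<lambda>x. W i (x, s)) \<in> borel_measurable borel" by (rule integrable_lborel_borel[OF int])
    have "integrable lebesgue (\<lambda>x. W i (x, s))"
      using int m by (simp add: integrable_completion)
    from integrable_lebesgue_cong_AE(1)[OF ae'' this]
    show ?thesis
      unfolding fourier_def using fourier_L1_eq_ft[OF m ae'] by simp
  qed
  then show ?thesis
    by (simp add: fun_eq_iff teodorescu_spectrum_def bq_fourier_def slice_ft_def)
qed

lemma norm_biquat_square: "(norm (q :: biquat))\<^sup>2 = (\<Sum>i\<in>UNIV. (cmod (q $ i))\<^sup>2)"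
  by (simp add: norm_vec_def L2_set_def sum_nonneg)

lemma nn_integral_norm_biquat_square:
  fixes f :: "'a \<Rightarrow> biquat"
  assumes [measurable]: "f \<in> borel_measurable M"
  shows "(\<integral>\<^sup>+x. ennreal ((norm (f x))\<^sup>2) \<partial>M) = (\<Sum>i\<in>UNIV. \<integral>\<^sup>+x. ennreal ((cmod (f x $ i))\<^sup>2) \<partial>M)"
  unfolding norm_biquat_square by (subst nn_integral_sum[symmetric]) (auto simp: sum_ennreal)

text \<open>
  The version is assembled from the four component transforms of the spectrum, reflected at the origin
  because the inverse transform is evaluated through the forward one. The bound \<open>C\<close> is independent of
  \<open>t\<close>; Bessel's inequality, used once for the slice and once for the spectrum, makes it integrable.
\<close>

lemma borel_teodorescu_integrand:
  fixes W :: "4 \<Rightarrow> (real ^ 3) \<times> real \<Rightarrow> complex"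
  assumes W [measurable]: "\<And>i. W i \<in> borel_measurable borel"
    and fin: "\<And>i. (\<integral>\<^sup>+p. ennreal ((cmod (W i p))\<^sup>2) \<partial>lborel) < \<infinity>"
    and \<sigma>: "\<sigma> \<in> {1, -1}"
  obtains H :: "(real ^ 3) \<times> real \<times> real \<Rightarrow> biquat" and C :: "real \<Rightarrow> ennreal" where
    "H \<in> borel_measurable borel" "C \<in> borel_measurable borel" "(\<integral>\<^sup>+s. C s \<partial>lborel) < \<infinity>"
    "AE s in lborel. \<forall>t.
       (\<forall>j. is_fourier_L2 (\<lambda>k. (quat_exp \<sigma> k (t - s) \<odot> slice_ft W s k) $ j) (\<lambda>x. H (- x, t, s) $ j)) \<and>
       (\<integral>\<^sup>+x. ennreal ((norm (H (x, t, s)))\<^sup>2) \<partial>lborel) \<le> C s"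
proof -
  have ft_m [measurable]: "(\<lambda>q. ft (\<lambda>x. W i (x, fst q)) (snd q)) \<in> borel_measurable borel" for i
  proof -
    have "(\<lambda>q. ft (\<lambda>x. W i (x, fst q)) (snd q)) \<in> borel_measurable (borel \<Otimes>\<^sub>M borel)" by measurable
    then show ?thesis by (simp add: borel_prod)
  qed
  have s_m [measurable]: "(\<lambda>q. slice_ft W (fst q) (snd q)) \<in> borel_measurable borel"
    unfolding slice_ft_def by measurable
  define S where "S j = (\<lambda>((t, s), k). (quat_exp \<sigma> k (t - s) \<odot> slice_ft W s k) $ j)" for j
  define G where "G = (\<lambda>(s, k). ennreal (16 * (norm (slice_ft W s k))\<^sup>2))"
  have s_m' [measurable]: "(\<lambda>q. slice_ft W (f q) (g q)) \<in> borel_measurable borel"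
    if [measurable]: "f \<in> borel_measurable borel" "g \<in> borel_measurable borel" for f :: "'x::topological_space \<Rightarrow> real" and g
    using measurable_compose[OF _ s_m, of "\<lambda>q. (f q, g q)" borel] by simp
  have S_m: "S j \<in> borel_measurable borel" for j
    unfolding S_def split_beta' by measurable
  have G_m [measurable]: "G \<in> borel_measurable borel"
    unfolding G_def split_beta' by measurable
  have le: "ennreal ((cmod (S j (p, k)))\<^sup>2) \<le> G (snd p, k)" for j p k
  proof -
    have "cmod (S j (p, k)) \<le> 4 * norm (slice_ft W (snd p) k)"
      unfolding S_def split_beta' using norm_bq_times_nth_le norm_quat_exp_nth_le[OF \<sigma>] by simp
    from power_mono[OF this norm_ge_zero, of 2] show ?thesis
      by (simp add: G_def power_mult_distrib ennreal_leI)
  qed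
  \<comment> \<open>the total energy of the majorant is controlled by the \<open>L\<^sup>2\<close> norm of the data\<close>
  have G_fin: "(\<integral>\<^sup>+s. (\<integral>\<^sup>+k. G (s, k) \<partial>lborel) \<partial>lborel) < \<infinity>"
  proof -
    have m: "(\<lambda>s. \<integral>\<^sup>+x. ennreal ((cmod (W i (x, s)))\<^sup>2) \<partial>lborel) \<in> borel_measurable borel" for i
    proof -
      have "(\<lambda>(s, x). ennreal ((cmod (W i (x, s)))\<^sup>2)) \<in> borel_measurable (borel \<Otimes>\<^sub>M lborel)"
        by (rule borel_measurable_pair_lborel) (unfold split_beta', measurable)
      from lborel.borel_measurable_nn_integral_fst[OF this] show ?thesis by simp
    qed
    have "(\<integral>\<^sup>+k. G (s, k) \<partial>lborel) \<le> (\<Sum>i\<in>UNIV. 16 * (\<integral>\<^sup>+x. ennreal ((cmod (W i (x, s)))\<^sup>2) \<partial>lborel))" for s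
    proof -
      have "(\<integral>\<^sup>+k. G (s, k) \<partial>lborel) = 16 * (\<integral>\<^sup>+k. ennreal ((norm (slice_ft W s k))\<^sup>2) \<partial>lborel)"
        by (simp add: G_def ennreal_mult nn_integral_cmult)
      also have "\<dots> = (\<Sum>i\<in>UNIV. 16 * (\<integral>\<^sup>+k. ennreal ((cmod (slice_ft W s k $ i))\<^sup>2) \<partial>lborel))"
        by (subst nn_integral_norm_biquat_square) (simp_all add: sum_distrib_left)
      also have "\<dots> \<le> (\<Sum>i\<in>UNIV. 16 * (\<integral>\<^sup>+x. ennreal ((cmod (W i (x, s)))\<^sup>2) \<partial>lborel))"
        unfolding slice_ft_def vec_lambda_beta
        by (intro sum_mono mult_left_mono bessel_inequality) auto
      finally show ?thesis .
    qed
    then have "(\<integral>\<^sup>+s. (\<integral>\<^sup>+k. G (s, k) \<partial>lborel) \<partial>lborel)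
        \<le> (\<integral>\<^sup>+s. (\<Sum>i\<in>UNIV. 16 * (\<integral>\<^sup>+x. ennreal ((cmod (W i (x, s)))\<^sup>2) \<partial>lborel)) \<partial>lborel)"
      by (intro nn_integral_mono)
    also have "\<dots> = (\<Sum>i\<in>UNIV. 16 * (\<integral>\<^sup>+p. ennreal ((cmod (W i p))\<^sup>2) \<partial>lborel))"
      using m nn_integral_lborel_iterated(2)[of "\<lambda>p. ennreal ((cmod (W _ p))\<^sup>2)"]
      by (simp add: nn_integral_sum nn_integral_cmult)
    also have "\<dots> < \<infinity>"
      using fin by (simp add: ennreal_mult_less_top)
    finally show ?thesis .
  qed
  define transf where "transf j h \<longleftrightarrow> h \<in> borel_measurable borel \<and> (AE s in lborel. \<forall>p. snd p = s \<longrightarrow>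
       is_fourier_L2 (\<lambda>k. S j (p, k)) (\<lambda>x. h (x, p)) \<and>
       (\<integral>\<^sup>+x. ennreal ((cmod (h (x, p)))\<^sup>2) \<partial>lborel) \<le> (\<integral>\<^sup>+k. G (s, k) \<partial>lborel))" for j h
  have "\<exists>h. transf j h" for j
    unfolding transf_def by (rule fourier_L2_parametrized[OF S_m G_m le G_fin]) blast
  then obtain h where trans: "\<And>j. transf j (h j)" by metis
  then have h_m [measurable]: "\<And>j. h j \<in> borel_measurable borel"
    and h: "\<And>j. AE s in lborel. \<forall>p. snd p = s \<longrightarrow>
       is_fourier_L2 (\<lambda>k. S j (p, k)) (\<lambda>x. h j (x, p)) \<and>
       (\<integral>\<^sup>+x. ennreal ((cmod (h j (x, p)))\<^sup>2) \<partial>lborel) \<le> (\<integral>\<^sup>+k. G (s, k) \<partial>lborel)"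
    unfolding transf_def by blast+
  define H where "H z = (\<chi> j. h j (- fst z, snd z))" for z :: "(real ^ 3) \<times> real \<times> real"
  define C where "C s = 4 * (\<integral>\<^sup>+k. G (s, k) \<partial>lborel)" for s
  show thesis
  proof
    show H_m [measurable]: "H \<in> borel_measurable borel" unfolding H_def[abs_def] by measurable
    have "G \<in> borel_measurable (borel \<Otimes>\<^sub>M lborel)"
      by (rule borel_measurable_pair_lborel) measurable
    note m = lborel.borel_measurable_nn_integral_fst[OF this]
    then show "C \<in> borel_measurable borel" unfolding C_def[abs_def] by measurable
    show "(\<integral>\<^sup>+s. C s \<partial>lborel) < \<infinity>"
      using G_fin m unfolding C_def by (simp add: nn_integral_cmult ennreal_mult_less_top)
    have "AE s in lborel. \<forall>j. \<forall>p. snd p = s \<longrightarrow>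
       is_fourier_L2 (\<lambda>k. S j (p, k)) (\<lambda>x. h j (x, p)) \<and>
       (\<integral>\<^sup>+x. ennreal ((cmod (h j (x, p)))\<^sup>2) \<partial>lborel) \<le> (\<integral>\<^sup>+k. G (s, k) \<partial>lborel)"
      using h by (simp add: AE_all_countable)
    then show "AE s in lborel. \<forall>t.
       (\<forall>j. is_fourier_L2 (\<lambda>k. (quat_exp \<sigma> k (t - s) \<odot> slice_ft W s k) $ j) (\<lambda>x. H (- x, t, s) $ j)) \<and>
       (\<integral>\<^sup>+x. ennreal ((norm (H (x, t, s)))\<^sup>2) \<partial>lborel) \<le> C s"
    proof (eventually_elim, intro allI conjI)
      fix s t j
      assume *: "\<forall>j. \<forall>p. snd p = s \<longrightarrow>
       is_fourier_L2 (\<lambda>k. S j (p, k)) (\<lambda>x. h j (x, p)) \<and>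
       (\<integral>\<^sup>+x. ennreal ((cmod (h j (x, p)))\<^sup>2) \<partial>lborel) \<le> (\<integral>\<^sup>+k. G (s, k) \<partial>lborel)"
      show "is_fourier_L2 (\<lambda>k. (quat_exp \<sigma> k (t - s) \<odot> slice_ft W s k) $ j) (\<lambda>x. H (- x, t, s) $ j)"
        using *[rule_format, of "(t, s)" j] by (simp add: S_def H_def)
      have "(\<integral>\<^sup>+x. ennreal ((norm (H (x, t, s)))\<^sup>2) \<partial>lborel)
          = (\<Sum>j\<in>UNIV. \<integral>\<^sup>+x. ennreal ((cmod (h j (- x, t, s)))\<^sup>2) \<partial>lborel)"
        by (subst nn_integral_norm_biquat_square) (simp_all add: H_def)
      also have "\<dots> = (\<Sum>j\<in>UNIV. \<integral>\<^sup>+x. ennreal ((cmod (h j (x, t, s)))\<^sup>2) \<partial>lborel)"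
        by (intro sum.cong refl nn_integral_lborel_uminus) measurable
      also have "\<dots> \<le> (\<Sum>j\<in>(UNIV::4 set). \<integral>\<^sup>+k. G (s, k) \<partial>lborel)"
        using * by (intro sum_mono) simp
      also have "\<dots> = C s" by (simp add: C_def)
      finally show "(\<integral>\<^sup>+x. ennreal ((norm (H (x, t, s)))\<^sup>2) \<partial>lborel) \<le> C s" .
    qed
  qed
qed

lemma bq_fourier_inv_AE:
  assumes "\<And>j. is_fourier_L2 (\<lambda>k. f k $ j) (\<lambda>x. H (- x) $ j)"
  shows "AE x in lborel. bq_fourier_inv f x = H x"
proof -
  have "AE x in lborel. \<forall>j. fourier (\<lambda>k. f k $ j) x = H (- x) $ j"
    using fourier_eq_AE[OF assms] by (simp add: AE_all_countable)
  from AE_lborel_uminus[OF this] show ?thesis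
    by eventually_elim (simp add: bq_fourier_inv_def bq_fourier_def vec_eq_iff)
qed

lemma open_time_triangle:
  "open {(t::real, s). 0 < s \<and> s < t}"
  "open {(x::'a::topological_space, t::real, s). 0 < s \<and> s < t}"
  unfolding split_beta' by (intro open_Collect_conj open_Collect_less continuous_intros)+

lemma teodorescu_versionI:
  assumes H: "H \<in> borel_measurable borel"
    and ae: "AE s in lborel. \<forall>t. AE x in lborel. bq_fourier_inv (teodorescu_spectrum \<Omega> \<sigma> w t s) x = H (x, t, s)"
  shows "teodorescu_version \<Omega> \<sigma> w H"
  unfolding teodorescu_version_def
proof
  show "H \<in> borel_measurable (lebesgue_on {(x, t, s). 0 < s \<and> s < t})"
    using H by (intro measurable_restrict_space1 measurable_completion) simp
  have "AE q in lborel. AE x in lborel. H (x, fst q, snd q) = bq_fourier_inv (teodorescu_spectrum \<Omega> \<sigma> w (fst q) (snd q)) x"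
    using AE_lborel_snd[OF ae, where 'a = real]
  proof eventually_elim
    case (elim q)
    from spec[OF elim, of "fst q"] show ?case by (elim eventually_mono) simp
  qed
  then have "AE q in lebesgue. q \<in> {(t, s). 0 < s \<and> s < t} \<longrightarrow>
      (case q of (t, s) \<Rightarrow> AE x in lebesgue. H (x, t, s) = bq_fourier_inv (teodorescu_spectrum \<Omega> \<sigma> w t s) x)"
    by (intro AE_completion, elim eventually_mono) (auto simp: AE_completion_iff)
  then show "AE (t, s) in lebesgue_on {(t, s). 0 < s \<and> s < t}.
        AE x in lebesgue. H (x, t, s) = bq_fourier_inv (teodorescu_spectrum \<Omega> \<sigma> w t s) x"
    by (subst AE_restrict_space_iff) (auto intro: sets_completionI_sets borel_open open_time_triangle)
qed

text \<open>
  For almost every \<open>(t, s)\<close> both functions are versions of the same class, so the set where they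
  differ has null sections; it is Lebesgue measurable because both functions are, hence null.
\<close>

lemma teodorescu_version_unique:
  assumes H: "H \<in> borel_measurable borel"
    and ae: "AE s in lborel. \<forall>t. AE x in lborel. bq_fourier_inv (teodorescu_spectrum \<Omega> \<sigma> w t s) x = H (x, t, s)"
    and v: "teodorescu_version \<Omega> \<sigma> w H'"
  shows "AE z in lborel. case z of (x, t, s) \<Rightarrow> 0 < s \<and> s < t \<longrightarrow> H' (x, t, s) = H (x, t, s)"
proof -
  define D where "D = {(x::real^3, t::real, s). 0 < s \<and> s < t}"
  have D: "D \<in> sets lebesgue" unfolding D_def by (auto intro: sets_completionI_sets borel_open open_time_triangle)
  have m: "(\<lambda>z. if z \<in> D then H' z else 0) \<in> borel_measurable lebesgue"
    using v D unfolding teodorescu_version_def D_def by (intro borel_measurable_if_I) auto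
  have "H \<in> borel_measurable (lebesgue_on D)"
    using H by (intro measurable_restrict_space1 measurable_completion) simp
  then have m': "(\<lambda>z. if z \<in> D then H z else 0) \<in> borel_measurable lebesgue"
    using D by (intro borel_measurable_if_I) auto
  have "{z \<in> space lebesgue. (if z \<in> D then H' z else 0) \<noteq> (if z \<in> D then H z else 0)} \<in> sets lebesgue"
    using m m' by measurable
  then have meas: "{z. \<not> (z \<in> D \<longrightarrow> H' z = H z)} \<in> sets lebesgue"
    by (rule back_subst[of "\<lambda>A. A \<in> sets lebesgue"]) auto
  have "AE q in lborel. q \<in> {(t, s). 0 < s \<and> s < t} \<longrightarrow>
      (case q of (t, s) \<Rightarrow> AE x in lborel. H' (x, t, s) = bq_fourier_inv (teodorescu_spectrum \<Omega> \<sigma> w t s) x)"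
    using v unfolding teodorescu_version_def
    by (subst (asm) AE_restrict_space_iff) (auto intro: sets_completionI_sets borel_open open_time_triangle simp: AE_completion_iff)
  with AE_lborel_snd[OF ae, where 'a = real]
  have "AE q in lborel. AE x in lborel. (x, q) \<in> D \<longrightarrow> H' (x, q) = H (x, q)"
  proof eventually_elim
    case (elim q)
    show ?case
    proof (cases "0 < snd q \<and> snd q < fst q")
      case True
      from elim(1) have "AE x in lborel. bq_fourier_inv (teodorescu_spectrum \<Omega> \<sigma> w (fst q) (snd q)) x = H (x, fst q, snd q)" ..
      moreover from elim(2) True
      have "AE x in lborel. H' (x, fst q, snd q) = bq_fourier_inv (teodorescu_spectrum \<Omega> \<sigma> w (fst q) (snd q)) x"
        by (simp add: split_beta')
      ultimately show ?thesis by eventually_elim simp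
    qed (auto simp: D_def)
  qed
  from AE_lborel_prodI[OF meas this] show ?thesis
    by eventually_elim (auto simp: D_def)
qed

text \<open>
  The bound on the slices is uniform in \<open>t\<close>, hence it can be integrated over \<open>t \<in> [-n, n]\<close>, and
  Tonelli's theorem shows that the inner integral over \<open>s\<close> is finite almost everywhere. The countably
  many \<open>n\<close> cover all times.
\<close>

lemma time_slices_square_integrable:
  fixes H :: "(real ^ 3) \<times> real \<times> real \<Rightarrow> biquat"
  assumes H [measurable]: "H \<in> borel_measurable borel" and C [measurable]: "C \<in> borel_measurable borel"
    and fin: "(\<integral>\<^sup>+s. C s \<partial>lborel) < \<infinity>"
    and le: "AE s in lborel. \<forall>t. (\<integral>\<^sup>+x. ennreal ((norm (H (x, t, s)))\<^sup>2) \<partial>lborel) \<le> C s"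
  shows "AE (x, t) in lborel. (\<integral>\<^sup>+s. ennreal ((norm (H (x, t, s)))\<^sup>2) \<partial>lborel) < \<infinity>"
proof -
  have "AE (x, t) in lborel. t \<in> {- real n .. real n} \<longrightarrow> (\<integral>\<^sup>+s. ennreal ((norm (H (x, t, s)))\<^sup>2) \<partial>lborel) < \<infinity>" for n
  proof -
    define f where "f z = indicator {- real n .. real n} (fst (snd z)) * ennreal ((norm (H z))\<^sup>2)" for z
    have f [measurable]: "f \<in> borel_measurable borel" unfolding f_def[abs_def] by measurable
    have "(\<integral>\<^sup>+z. f z \<partial>lborel) = (\<integral>\<^sup>+q. (\<integral>\<^sup>+x. f (x, q) \<partial>lborel) \<partial>lborel)"
      by (rule nn_integral_lborel_iterated(2)[OF f, symmetric])
    also have "\<dots> \<le> (\<integral>\<^sup>+q. indicator {- real n .. real n} (fst q) * C (snd q) \<partial>lborel)"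
    proof (rule nn_integral_mono_AE)
      show "AE q in lborel. (\<integral>\<^sup>+x. f (x, q) \<partial>lborel) \<le> indicator {- real n .. real n} (fst q) * C (snd q)"
        using AE_lborel_snd[OF le, where 'a = real]
      proof eventually_elim
        case (elim q)
        have "(\<integral>\<^sup>+x. f (x, q) \<partial>lborel) = indicator {- real n .. real n} (fst q) * (\<integral>\<^sup>+x. ennreal ((norm (H (x, fst q, snd q)))\<^sup>2) \<partial>lborel)"
          unfolding f_def by (subst nn_integral_cmult[symmetric]) auto
        also have "\<dots> \<le> indicator {- real n .. real n} (fst q) * C (snd q)"
          using elim[rule_format, of "fst q"] by (intro mult_left_mono) auto
        finally show ?case .
      qed
    qed
    also have "\<dots> = (\<integral>\<^sup>+t. (\<integral>\<^sup>+s. indicator {- real n .. real n} t * C s \<partial>lborel) \<partial>lborel)"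
      by (subst nn_integral_lborel_iterated(1)[symmetric]) auto
    also have "\<dots> = (\<integral>\<^sup>+s. C s \<partial>lborel) * emeasure lborel {- real n .. real n}"
      by (simp add: nn_integral_cmult nn_integral_multc mult.commute)
    also have "\<dots> < \<infinity>" using fin by (simp add: ennreal_mult_less_top)
    finally have fin_f: "(\<integral>\<^sup>+z. f z \<partial>lborel) < \<infinity>" .
    have "(\<lambda>(q, s). f (fst q, snd q, s)) \<in> borel_measurable (borel \<Otimes>\<^sub>M lborel)"
      by (rule borel_measurable_pair_lborel) (unfold split_beta', measurable)
    note m = lborel.borel_measurable_nn_integral_fst[OF this]
    have "AE q in lborel. (\<integral>\<^sup>+s. f (fst q, snd q, s) \<partial>lborel) \<noteq> \<infinity>"
      using fin_f m nn_integral_lborel_regroup[OF f]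
      by (intro nn_integral_PInf_AE) (auto simp: split_beta')
    then show ?thesis
      by eventually_elim (auto simp: f_def split_beta' less_top)
  qed
  then have "AE q in lborel. \<forall>n. case q of (x, t) \<Rightarrow> t \<in> {- real n .. real n} \<longrightarrow> (\<integral>\<^sup>+s. ennreal ((norm (H (x, t, s)))\<^sup>2) \<partial>lborel) < \<infinity>"
    by (subst AE_all_countable) (rule allI)
  then show ?thesis
  proof eventually_elim
    case (elim q)
    obtain n :: nat where "\<bar>snd q\<bar> \<le> real n" using real_arch_simple by blast
    then show ?case using elim[rule_format, of n] by (auto simp: split_beta')
  qed
qed


text \<open>
  Completeness of Lebesgue measure transfers integrability from a Borel function to any function that
  agrees with it almost everywhere; measurability of \<open>f\<close> is a consequence.
\<close>

lemma set_integral_lebesgue_eq: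
  fixes f g :: "real \<Rightarrow> biquat"
  assumes [measurable]: "g \<in> borel_measurable borel"
    and fin: "(\<integral>\<^sup>+s. ennreal ((norm (g s))\<^sup>2) \<partial>lborel) < \<infinity>"
    and ae: "AE s in lborel. s \<in> {0<..<t} \<longrightarrow> f s = g s"
  shows "set_integrable lebesgue {0<..<t} f"
    and "(LINT s:{0<..<t}|lebesgue. f s) = (LINT s:{0<..<t}|lborel. g s)"
proof -
  have "(\<integral>\<^sup>+s. ennreal ((norm (indicator {0<..<t} s *\<^sub>R g s))\<^sup>2) \<partial>lborel) \<le> (\<integral>\<^sup>+s. ennreal ((norm (g s))\<^sup>2) \<partial>lborel)"
    by (intro nn_integral_mono) (simp add: indicator_def)
  then have "integrable lborel (\<lambda>s. indicator {0<..<t} s *\<^sub>R g s)"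
    using fin emeasure_bounded_finite[OF bounded_Ioo, of 0 t]
    by (intro integrable_of_square_integrable[where A = "{0<..<t}"]) auto
  then have g: "integrable lebesgue (\<lambda>s. indicator {0<..<t} s *\<^sub>R g s)"
    by (simp add: integrable_completion)
  have "AE s in lborel. indicator {0<..<t} s *\<^sub>R g s = indicator {0<..<t} s *\<^sub>R f s"
    using ae by eventually_elim (auto simp: indicator_def)
  note cong = integrable_lebesgue_cong_AE[OF this g]
  from cong(1) show "set_integrable lebesgue {0<..<t} f" unfolding set_integrable_def .
  show "(LINT s:{0<..<t}|lebesgue. f s) = (LINT s:{0<..<t}|lborel. g s)"
    using cong(2) unfolding set_lebesgue_integral_def by (simp add: integral_completion)
qed

section \<open>The Teodorescu transform is well defined\<close>

theorem proposition9:
  fixes \<Omega> :: "(real ^ 3) set"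
    and w :: "(real ^ 3) \<times> real \<Rightarrow> biquat"
    and \<sigma> :: real
  assumes "open \<Omega>" and "connected \<Omega>" and "bounded \<Omega>" and "\<Omega> \<noteq> {}"
    and "w \<in> bq_L2_on (cylinder \<Omega>)"
    and "\<sigma> \<in> {1, -1}"
  shows
    "(AE s in lebesgue_on {0<..}.
        (\<lambda>x. zero_ext (cylinder \<Omega>) w (x, s)) \<in> bq_L2_on UNIV \<and>
        (\<forall>t>s. teodorescu_spectrum \<Omega> \<sigma> w t s \<in> bq_L2_on UNIV)) \<and>
     (\<exists>H. teodorescu_version \<Omega> \<sigma> w H) \<and>
     (\<forall>w' H. (AE p in lebesgue_on (cylinder \<Omega>). w' p = w p) \<longrightarrow>
        teodorescu_version \<Omega> \<sigma> w' H \<longrightarrow>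
        (AE (x, t) in lebesgue_on (UNIV \<times> {0<..}).
           set_integrable lebesgue {0<..<t} (\<lambda>s. H (x, t, s)) \<and>
           (LINT s:{0<..<t}|lebesgue. H (x, t, s)) = teodorescu \<Omega> \<sigma> w (x, t)))"
proof -
  obtain W where W [measurable]: "\<And>i. W i \<in> borel_measurable borel"
    and W0: "\<And>i p. p \<notin> cylinder \<Omega> \<Longrightarrow> W i p = 0"
    and W_w: "AE p in lborel. \<forall>i. zero_ext (cylinder \<Omega>) w p $ i = W i p"
    and W_fin: "\<And>i. (\<integral>\<^sup>+p. ennreal ((cmod (W i p))\<^sup>2) \<partial>lborel) < \<infinity>"
    by (rule cylinder_borel_rep[OF assms(1,5)], rule that, assumption+)
  obtain H0 C where H0: "H0 \<in> borel_measurable borel" and C: "C \<in> borel_measurable borel" "(\<integral>\<^sup>+s. C s \<partial>lborel) < \<infinity>"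
    and H0_C: "AE s in lborel. \<forall>t.
       (\<forall>j. is_fourier_L2 (\<lambda>k. (quat_exp \<sigma> k (t - s) \<odot> slice_ft W s k) $ j) (\<lambda>x. H0 (- x, t, s) $ j)) \<and>
       (\<integral>\<^sup>+x. ennreal ((norm (H0 (x, t, s)))\<^sup>2) \<partial>lborel) \<le> C s"
    by (rule borel_teodorescu_integrand[where W = W, OF W W_fin assms(6)])
  have slices: "AE s in lborel. \<forall>i. integrable lborel (\<lambda>x. W i (x, s)) \<and>
           (\<integral>\<^sup>+x. ennreal ((cmod (W i (x, s)))\<^sup>2) \<partial>lborel) < \<infinity>"
    by (intro slices_square_integrable[of \<Omega> W] assms W W0 W_fin)
  have spec: "AE s in lborel. (AE x in lborel. \<forall>i. zero_ext (cylinder \<Omega>) w' (x, s) $ i = W i (x, s)) \<and>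
      (\<forall>t. teodorescu_spectrum \<Omega> \<sigma> w' t s = (\<lambda>k. quat_exp \<sigma> k (t - s) \<odot> slice_ft W s k))"
    if "AE p in lebesgue_on (cylinder \<Omega>). w' p = w p" for w'
  proof -
    have "AE p in lborel. \<forall>i. zero_ext (cylinder \<Omega>) w' p $ i = W i p"
      using zero_ext_AE_cong[OF assms(1) that] W_w by eventually_elim simp
    from AE_lborel_prod_iterated_swap[OF this] slices show ?thesis
      by eventually_elim (auto intro!: teodorescu_spectrum_eq)
  qed
  \<comment> \<open>one Borel function \<open>H0\<close> serves all representatives \<open>w'\<close> of \<open>w\<close>, and the exceptional null set consists of times \<open>s\<close>\<close>
  have inv: "AE s in lborel. \<forall>t. AE x in lborel. bq_fourier_inv (teodorescu_spectrum \<Omega> \<sigma> w' t s) x = H0 (x, t, s)"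
    if "AE p in lebesgue_on (cylinder \<Omega>). w' p = w p" for w'
    using spec[OF that] H0_C
  proof (eventually_elim, intro allI)
    fix s t
    assume 1: "(AE x in lborel. \<forall>i. zero_ext (cylinder \<Omega>) w' (x, s) $ i = W i (x, s)) \<and>
        (\<forall>t. teodorescu_spectrum \<Omega> \<sigma> w' t s = (\<lambda>k. quat_exp \<sigma> k (t - s) \<odot> slice_ft W s k))"
      and 2: "\<forall>t. (\<forall>j. is_fourier_L2 (\<lambda>k. (quat_exp \<sigma> k (t - s) \<odot> slice_ft W s k) $ j) (\<lambda>x. H0 (- x, t, s) $ j)) \<and>
        (\<integral>\<^sup>+x. ennreal ((norm (H0 (x, t, s)))\<^sup>2) \<partial>lborel) \<le> C s"
    show "AE x in lborel. bq_fourier_inv (teodorescu_spectrum \<Omega> \<sigma> w' t s) x = H0 (x, t, s)"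
      by (rule bq_fourier_inv_AE[where H = "\<lambda>x. H0 (x, t, s)"]) (use 1 2 in simp)
  qed
  have w_w: "AE p in lebesgue_on (cylinder \<Omega>). w p = w p" by simp
  have version: "teodorescu_version \<Omega> \<sigma> w H0"
    by (rule teodorescu_versionI[OF H0 inv[OF w_w]])
  have L2: "AE s in lborel. (\<lambda>x. zero_ext (cylinder \<Omega>) w (x, s)) \<in> bq_L2_on UNIV \<and>
        (\<forall>t. teodorescu_spectrum \<Omega> \<sigma> w t s \<in> bq_L2_on UNIV)"
    using spec[OF w_w] H0_C slices
  proof eventually_elim
    case (elim s)
    have "(\<lambda>x. zero_ext (cylinder \<Omega>) w (x, s) $ i) \<in> L2_on UNIV" for i
    proof -
      have eq: "AE x in lborel. W i (x, s) = zero_ext (cylinder \<Omega>) w (x, s) $ i"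
        using conjunct1[OF elim(1)] by eventually_elim simp
      have "(\<lambda>x. W i (x, s)) \<in> borel_measurable lebesgue"
        by (rule measurable_completion) measurable
      from borel_measurable_AE[OF this AE_completion[OF eq]]
      have "(\<lambda>x. zero_ext (cylinder \<Omega>) w (x, s) $ i) \<in> borel_measurable lebesgue" .
      moreover have "(\<integral>\<^sup>+x. ennreal ((cmod (zero_ext (cylinder \<Omega>) w (x, s) $ i))\<^sup>2) \<partial>lborel)
          = (\<integral>\<^sup>+x. ennreal ((cmod (W i (x, s)))\<^sup>2) \<partial>lborel)"
        using eq by (intro nn_integral_cong_AE) (auto elim!: eventually_mono)
      ultimately show ?thesis using elim(3) by (simp add: L2_on_UNIV_iff)
    qed
    moreover have "(\<lambda>k. teodorescu_spectrum \<Omega> \<sigma> w t s k $ j) \<in> L2_on UNIV" for t j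
      using elim(1,2) by (auto simp: is_fourier_L2_def)
    ultimately show ?case by (simp add: bq_L2_on_def)
  qed
  have unique: "AE q in lborel. AE s in lborel. 0 < s \<and> s < snd q \<longrightarrow> H (fst q, snd q, s) = H0 (fst q, snd q, s)"
    if "AE p in lebesgue_on (cylinder \<Omega>). w' p = w p" and "teodorescu_version \<Omega> \<sigma> w' H" for w' H
    using AE_lborel_regroup[OF teodorescu_version_unique[OF H0 inv[OF that(1)] that(2)]]
    by (simp add: split_beta')
  \<comment> \<open>the version that enters the definition of the transform; it is compared with \<open>H0\<close> like any other\<close>
  define HS where "HS = (SOME H. teodorescu_version \<Omega> \<sigma> w H)"
  have HS: "teodorescu_version \<Omega> \<sigma> w HS"
    unfolding HS_def by (rule someI[of "teodorescu_version \<Omega> \<sigma> w", OF version])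
  have "AE s in lborel. \<forall>t. (\<integral>\<^sup>+x. ennreal ((norm (H0 (x, t, s)))\<^sup>2) \<partial>lborel) \<le> C s"
    using H0_C by eventually_elim blast
  note H0_fin = time_slices_square_integrable[OF H0 C this]
  have well_defined: "AE q in lborel. set_integrable lebesgue {0<..<snd q} (\<lambda>s. H (fst q, snd q, s)) \<and>
           (LINT s:{0<..<snd q}|lebesgue. H (fst q, snd q, s)) = teodorescu \<Omega> \<sigma> w q"
    if "AE p in lebesgue_on (cylinder \<Omega>). w' p = w p" and "teodorescu_version \<Omega> \<sigma> w' H" for w' H
    using H0_fin unique[OF that] unique[OF w_w HS]
  proof eventually_elim
    case (elim q)
    have m: "(\<lambda>s. H0 (fst q, snd q, s)) \<in> borel_measurable borel"
      using H0 by measurable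
    have f: "(\<integral>\<^sup>+s. ennreal ((norm (H0 (fst q, snd q, s)))\<^sup>2) \<partial>lborel) < \<infinity>"
      using elim(1) by (simp add: split_beta')
    have "AE s in lborel. s \<in> {0<..<snd q} \<longrightarrow> H (fst q, snd q, s) = H0 (fst q, snd q, s)"
      using elim(2) by eventually_elim simp
    note 1 = set_integral_lebesgue_eq[OF m f this]
    have "AE s in lborel. s \<in> {0<..<snd q} \<longrightarrow> HS (fst q, snd q, s) = H0 (fst q, snd q, s)"
      using elim(3) by eventually_elim simp
    note 2 = set_integral_lebesgue_eq[OF m f this]
    show ?case using 1 2 by (simp add: teodorescu_def HS_def split_beta')
  qed
  have T: "UNIV \<times> {0<..} \<inter> space lebesgue \<in> sets (lebesgue :: ((real ^ 3) \<times> real) measure)"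
    by (auto intro!: sets_completionI_sets borel_open open_Times)
  show ?thesis
  proof (intro conjI allI impI)
    show "AE s in lebesgue_on {0<..}.
        (\<lambda>x. zero_ext (cylinder \<Omega>) w (x, s)) \<in> bq_L2_on UNIV \<and>
        (\<forall>t>s. teodorescu_spectrum \<Omega> \<sigma> w t s \<in> bq_L2_on UNIV)"
      using AE_completion[OF L2] by (subst AE_restrict_space_iff, simp) (elim eventually_mono, blast)
    show "\<exists>H. teodorescu_version \<Omega> \<sigma> w H" using version by blast
    show "AE (x, t) in lebesgue_on (UNIV \<times> {0<..}).
           set_integrable lebesgue {0<..<t} (\<lambda>s. H (x, t, s)) \<and>
           (LINT s:{0<..<t}|lebesgue. H (x, t, s)) = teodorescu \<Omega> \<sigma> w (x, t)"
      if "AE p in lebesgue_on (cylinder \<Omega>). w' p = w p" and "teodorescu_version \<Omega> \<sigma> w' H" for w' H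
      using AE_completion[OF well_defined[OF that]]
      by (subst AE_restrict_space_iff[OF T]) (elim eventually_mono, auto)
  qed
qed

end
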